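(* Let $\mathcal{X}$ be a topologically and scaling consistent ideal with a countable open base $(U_i)_{i\in\mathbb{N}}$ on a Polish space $X$ equipped with a continuous scaling $T$, and let $k\in\mathbb{N}$. Let $\eta$ be a point process with values in $M_p(\mathcal{X})$ such that $\mathbf{P}\{\eta(T_tU_i)=k\}>0$ for all $t\ge1$ and all $i\in\mathbb{N}$. Let $g:[0,\infty)\to[0,\infty)$ be a measurable function with $g(t)\to\infty$ as $t\to\infty$. Assume the following conditions. (i) There is a non-trivial $\mu\in M(\mathcal{X}^k(k))$ such that, for all Borel $B\in\mathcal{X}$ and all continuous bounded functions $h:X^k\to\mathbb{R}$ supported by $B^k$, $$g(t)\int_{X^k}h(T_{t^{-1}}x_1,\dots,T_{t^{-1}}x_k)\,J_{k,T_tB}(d(x_1,\dots,x_k))\to\int_{X^k}h\,d\mu\quad\text{as }t\to\infty.$$ (ii) For all $i\in\mathbb{N}$, $g(t)\mathbf{P}\{\eta(T_tU_i)\ge k+1\}\to0$ as $t\to\infty$. Then $\eta\in\mathrm{RV}(M_p(\mathcal{X}),T,\mathcal{M}_p^{(k)}(\mathcal{X}),g,\mu^*_{(k)})$, where the tail measure $$\mu^*_{(k)}(D)=\int_{X^k}\mathbf{1}\Big\{\sum_{i=1}^k\delta_{x_i}\in D\Big\}\,\mu(d(x_1,\dots,x_k)),\qquad D\in\mathcal{M}_p^{(k)}(\mathcal{X})\text{ Borel},$$ is the pushforward of $\mu$ under the map $(x_1,\dots,x_k)\mapsto\sum_{i=1}^k\delta_{x_i}$.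
   Context: A continuous scaling is a family of maps $T_t:X\to X$, $t>0$, with $T_tT_s=T_{ts}$, $T_1=\mathrm{id}$, $(x,t)\mapsto T_tx$ jointly continuous. An ideal $\mathcal{S}$ is a family of subsets closed under finite unions and subsets, with union $U_{\mathcal{S}}$; scaling consistent if $T_tB\in\mathcal{S}$ for $B\in\mathcal{S}$, $t>0$; topologically consistent (in metric spaces) if each $B\in\mathcal{S}$ lies in a closed member of $\mathcal{S}$ and each point of $U_{\mathcal{S}}$ has an open neighbourhood in $\mathcal{S}$. A countable open base is a countable family of open sets in $\mathcal{S}$ such that each member of $\mathcal{S}$ is contained in one of them. $M(\mathcal{S})$: Borel measures finite on Borel sets in $\mathcal{S}$ and vanishing outside $U_{\mathcal{S}}$; non-trivial means $\mu(B)>0$ for some $B\in\mathcal{S}$. $C(X,\mathcal{S})$: bounded continuous $f:U_{\mathcal{S}}\to\mathbb{R}$ with support (closure in $X$ of $\{f\ne0\}$) in $\mathcal{S}$. Vague topology on $M(\mathcal{S})$: generated by $\mu\mapsto\int f\,d\mu$, $f\in C(X,\mathcal{S})$. $\mathcal{X}^k(k)$ is the ideal on $X^k$ of all subsets of sets $A^k$, $A\in\mathcal{X}$. $M_p(\mathcal{X})\subset M(\mathcal{X})$ is the set of measures with non-negative integer values (on sets of $\mathcal{X}$), with the vague topology (a Polish space) and scaling $(T_tm)(A)=m(T_{t^{-1}}A)$; a point process is a random element of it. $\mathcal{M}_p^{(k)}(\mathcal{X})$ is the ideal of all $D\subset M_p(\mathcal{X})$ for which there is a Borel $A\in\mathcal{X}$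 with $m(A)\ge k$ for all $m\in D$. For $m=\sum_i\delta_{x_i}$ (atoms listed with multiplicities), $m^{(k)}=\sum\delta_{(x_{i_1},\dots,x_{i_k})}$ over $k$-tuples of pairwise distinct indices. The Janossy measure of $\eta$ is $J_{k,B}(A)=\frac1{k!}\mathbf{E}\big[\mathbf{1}\{\eta(B)=k\}\,\eta^{(k)}(A\cap B^k)\big]$, for Borel $A\subset X^k$. $\eta\in\mathrm{RV}(E,T,\mathcal{S},g,\mu)$ (for a space $E$ with scaling $T$ and ideal $\mathcal{S}$) means: $g$ measurable, $g(t)\to\infty$, $\mu\in M(\mathcal{S})$ non-trivial, and $g(t)\mathbf{E}f(T_{t^{-1}}\eta)\to\int f\,d\mu$ as $t\to\infty$ for all $f\in C(E,\mathcal{S})$. *)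

theory Defs
  imports "HOL-Probability.Probability"
begin

definition continuous_scaling :: "'e topology \<Rightarrow> (real \<Rightarrow> 'e \<Rightarrow> 'e) \<Rightarrow> bool" where
  "continuous_scaling E T \<longleftrightarrow>
     (\<forall>t>0. \<forall>x\<in>topspace E. T t x \<in> topspace E) \<and>
     (\<forall>t>0. \<forall>s>0. \<forall>x\<in>topspace E. T t (T s x) = T (t * s) x) \<and>
     (\<forall>x\<in>topspace E. T 1 x = x) \<and>
     continuous_map (prod_topology E (top_of_set {0<..})) E (\<lambda>(x, t). T t x)"

definition ideal_on :: "'e topology \<Rightarrow> 'e set set \<Rightarrow> bool" where
  "ideal_on E S \<longleftrightarrow> S \<subseteq> Pow (topspace E) \<and> {} \<in> S \<and>
     (\<forall>A\<in>S. \<forall>B\<in>S. A \<union> B \<in> S) \<and> (\<forall>A\<in>S. \<forall>B. B \<subseteq> A \<longrightarrow> B \<in> S)"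

definition scaling_consistent :: "(real \<Rightarrow> 'e \<Rightarrow> 'e) \<Rightarrow> 'e set set \<Rightarrow> bool" where
  "scaling_consistent T S \<longleftrightarrow> (\<forall>B\<in>S. \<forall>t>0. T t ` B \<in> S)"

definition topologically_consistent :: "'e topology \<Rightarrow> 'e set set \<Rightarrow> bool" where
  "topologically_consistent E S \<longleftrightarrow>
     (\<forall>B\<in>S. \<exists>C\<in>S. closedin E C \<and> B \<subseteq> C) \<and>
     (\<forall>x\<in>\<Union>S. \<exists>V\<in>S. openin E V \<and> x \<in> V)"

definition countable_open_base :: "'e topology \<Rightarrow> 'e set set \<Rightarrow> (nat \<Rightarrow> 'e set) \<Rightarrow> bool" where
  "countable_open_base E S U \<longleftrightarrow>
     (\<forall>i. openin E (U i) \<and> U i \<in> S) \<and> (\<forall>B\<in>S. \<exists>i. B \<subseteq> U i)"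

definition borel_on :: "'e topology \<Rightarrow> 'e measure" where
  "borel_on E = sigma (topspace E) {V. openin E V}"

lemma borel_on_euclidean [simp]: "borel_on (euclidean :: 'a::topological_space topology) = borel"
  by (simp add: borel_on_def borel_def)

definition ideal_measures :: "'e topology \<Rightarrow> 'e set set \<Rightarrow> 'e measure set" where
  "ideal_measures E S =
     {\<mu>. sets \<mu> = sets (borel_on E) \<and>
         (\<forall>B\<in>S \<inter> sets (borel_on E). emeasure \<mu> B < \<infinity>) \<and>
         (\<forall>A\<in>sets (borel_on E). A \<inter> \<Union>S = {} \<longrightarrow> emeasure \<mu> A = 0)}"

definition nontrivial_on :: "'e set set \<Rightarrow> 'e measure \<Rightarrow> bool" where
  "nontrivial_on S \<mu> \<longleftrightarrow> (\<exists>B\<in>S \<inter> sets \<mu>. emeasure \<mu> B > 0)"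

text \<open>A real function on \<^term>\<open>\<Union>S\<close> is represented by its extension by zero to the whole type.\<close>

definition ideal_test_functions :: "'e topology \<Rightarrow> 'e set set \<Rightarrow> ('e \<Rightarrow> real) set" where
  "ideal_test_functions E S =
     {f. continuous_map (subtopology E (\<Union>S)) euclideanreal f \<and>
         bounded (f ` \<Union>S) \<and>
         E closure_of {x \<in> \<Union>S. f x \<noteq> 0} \<in> S \<and>
         (\<forall>x. x \<notin> \<Union>S \<longrightarrow> f x = 0)}"

definition vague_topology :: "'e topology \<Rightarrow> 'e set set \<Rightarrow> 'e measure topology" where
  "vague_topology E S = topology_generated_by
     {{\<mu> \<in> ideal_measures E S. (\<integral>x. f x \<partial>\<mu>) \<in> V} | f V.
        f \<in> ideal_test_functions E S \<and> open V}"

definition regularly_varying ::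
  "'w measure \<Rightarrow> ('w \<Rightarrow> 'e) \<Rightarrow> 'e topology \<Rightarrow> (real \<Rightarrow> 'e \<Rightarrow> 'e) \<Rightarrow> 'e set set
     \<Rightarrow> (real \<Rightarrow> real) \<Rightarrow> 'e measure \<Rightarrow> bool" where
  "regularly_varying P \<xi> E T S g \<mu> \<longleftrightarrow>
     prob_space P \<and> \<xi> \<in> measurable P (borel_on E) \<and>
     g \<in> borel_measurable (restrict_space borel {0..}) \<and> (\<forall>t\<ge>0. 0 \<le> g t) \<and>
     filterlim g at_top at_top \<and>
     \<mu> \<in> ideal_measures E S \<and> nontrivial_on S \<mu> \<and>
     (\<forall>f\<in>ideal_test_functions E S.
        ((\<lambda>t. g t * (\<integral>\<omega>. f (T (inverse t) (\<xi> \<omega>)) \<partial>P)) \<longlongrightarrow> (\<integral>x. f x \<partial>\<mu>)) at_top)"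

definition counting_measures :: "'a::topological_space set set \<Rightarrow> 'a measure set" where
  "counting_measures \<X> =
     {m \<in> ideal_measures euclidean \<X>. \<forall>A\<in>\<X> \<inter> sets borel. \<exists>n::nat. emeasure m A = of_nat n}"

definition counting_space :: "'a::topological_space set set \<Rightarrow> 'a measure topology" where
  "counting_space \<X> = subtopology (vague_topology euclidean \<X>) (counting_measures \<X>)"

text \<open>For a scaling, the preimage of \<open>A\<close> under \<open>T t\<close> is the image of \<open>A\<close> under
  \<open>T (inverse t)\<close>, so the push-forward is \<open>A \<mapsto> m (T (inverse t) ` A)\<close>.\<close>

definition push_scaling ::
  "(real \<Rightarrow> 'a \<Rightarrow> 'a) \<Rightarrow> real \<Rightarrow> 'a measure \<Rightarrow> 'a::topological_space measure" where
  "push_scaling T t m = distr m borel (T t)"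

definition counting_ideal :: "nat \<Rightarrow> 'a::topological_space set set \<Rightarrow> 'a measure set set" where
  "counting_ideal k \<X> =
     {D. D \<subseteq> counting_measures \<X> \<and>
         (\<exists>A\<in>\<X> \<inter> sets borel. \<forall>m\<in>D. emeasure m A \<ge> of_nat k)}"

text \<open>The power \<open>X\<^sup>k\<close> is the type \<^typ>\<open>'k \<Rightarrow> 'a\<close> for a finite index type with
  \<open>k = CARD('k)\<close>, carrying the product topology.\<close>

definition set_power :: "'a set \<Rightarrow> ('k \<Rightarrow> 'a) set" where
  "set_power A = {x. \<forall>i. x i \<in> A}"

definition power_ideal :: "'a set set \<Rightarrow> ('k \<Rightarrow> 'a) set set" where
  "power_ideal \<X> = {D. \<exists>A\<in>\<X>. D \<subseteq> set_power A}"

text \<open>The sum of unit point masses at the points \<open>x i\<close>, \<open>i \<in> I\<close>, is the image of the counting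
  measure on \<open>I\<close>; repeated points are counted with multiplicity.\<close>

definition dirac_sum :: "'i set \<Rightarrow> ('i \<Rightarrow> 'b) \<Rightarrow> 'b::topological_space measure" where
  "dirac_sum I x = distr (count_space I) borel x"

text \<open>The choice of the listing of atoms is immaterial: another listing differs by a bijection of
  the index sets, since points of the (Polish) spaces considered are Borel sets.\<close>

definition factorial_measure :: "'a::topological_space measure \<Rightarrow> ('k \<Rightarrow> 'a) measure" where
  "factorial_measure m =
     (case (SOME (I, x). m = dirac_sum I x) of (I :: nat set, x) \<Rightarrow>
        dirac_sum {\<iota>. inj \<iota> \<and> range \<iota> \<subseteq> I} (\<lambda>\<iota> j. x (\<iota> j)))"

definition janossy_measure ::
  "'w measure \<Rightarrow> ('w \<Rightarrow> 'a measure) \<Rightarrow> 'a set \<Rightarrow> ('k::finite \<Rightarrow> 'a::topological_space) measure" where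
  "janossy_measure P \<eta> B = measure_of UNIV (sets borel)
     (\<lambda>A. (\<integral>\<^sup>+\<omega>. indicator {\<omega>. emeasure (\<eta> \<omega>) B = of_nat CARD('k)} \<omega> *
                 emeasure (factorial_measure (\<eta> \<omega>)) (A \<inter> set_power B) \<partial>P) / fact CARD('k))"

definition tail_measure ::
  "'a set set \<Rightarrow> ('k::finite \<Rightarrow> 'a::topological_space) measure \<Rightarrow> 'a measure measure" where
  "tail_measure \<X> \<mu> =
     measure_of (space (borel_on (counting_space \<X>))) (sets (borel_on (counting_space \<X>)))
       (\<lambda>D. \<integral>\<^sup>+x. indicator D (dirac_sum UNIV x) \<partial>\<mu>)"

end

theory Submission
  imports Defs
begin

text \<open>
  Write \<open>k\<close> for the cardinality of the index type, \<open>\<eta>\<^sub>t\<close> for the rescaled process and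
  \<open>\<delta> x\<close> for the sum of the \<open>k\<close> unit masses at the coordinates of \<open>x\<close>.

  The Janossy measure of a window \<open>V\<close> describes \<open>\<eta>\<close> exactly where \<open>\<eta>(V) = k\<close>, and then it sees only
  the restriction of \<open>\<eta>\<close> to \<open>V\<close>.  A continuous function \<open>f\<close> on configurations, however, may depend on
  points far away from the set that carries the \<open>k\<close> points, so the assumed convergence of the
  Janossy measures cannot be applied to \<open>f\<close> itself.  The proof replaces \<open>f\<close> by functions of \<open>k\<close> points that lie below it.

  For continuous \<open>F \<ge> 0\<close> let \<open>G\<^sub>n x\<close> be the infimum of \<open>F m\<close> over all configurations \<open>m\<close> whose
  restriction to a large window \<open>W\<^sub>n\<close> is \<open>\<delta> x\<close>, and let \<open>h\<^sub>n\<close> be the \<open>n\<close>-Lipschitz minorant of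
  \<open>G\<^sub>n\<close>.  A basic vague neighbourhood of \<open>\<delta> x\<close> is given by finitely many test functions, all supported
  in some window, so \<open>h\<^sub>n x\<close> has lower limit at least \<open>F (\<delta> x)\<close> (lemma \<open>lower_approximation\<close>).
  Since \<open>h\<^sub>n\<close> is continuous with support in a window, the Janossy convergence applies to it, and Fatou's lemma yields
  \<open>liminf g(t) E F(\<eta>\<^sub>t) \<ge> \<integral> F (\<delta> x) d\<mu>\<close> (lemma \<open>eventually_greater_than_below_limit\<close>).

  For the upper bound one needs a continuous function \<open>\<psi>\<close> with \<open>0 \<le> \<psi> \<le> 1\<close> that equals 1 on the
  support of \<open>f\<close> and for which the full limit is known.  A function of a single vague integral
  works (lemma \<open>dominating_function_exists\<close>): it depends on one window only, so the Janossy convergence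
  controls it where the window has \<open>k\<close> points, the bound on the probability of excess points where there are
  more, and it vanishes where there are fewer.  If
  \<open>\<bar>f\<bar> \<le> M\<close>, the lower bound for \<open>M \<psi> + f\<close> and \<open>M \<psi> - f\<close> gives the limit of \<open>g(t) E f(\<eta>\<^sub>t)\<close>.

  To integrate with respect to the Janossy measure one has to know that the integral which defines it
  is a measure, that is, that the number of orderings of the points of \<open>m\<close> in \<open>V\<close> which fall into a
  given Borel set depends measurably on \<open>m\<close>.  For boxes, this number of injections satisfies a recursion in the
  number of coordinates (lemma \<open>card_injections_insert\<close>), whose ingredients are values \<open>m(A)\<close>; general
  Borel sets follow by a \<open>\<pi>\<close>-\<open>\<lambda>\<close> argument.  The Janossy measure is then a mixture
  over \<open>P\<close> of finitely supported kernels (lemma \<open>janossy_measure_eq_bind\<close>).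
\<close>

section \<open>Powers of sets and sums of point masses\<close>

lemma closure_set_power_subset:
  fixes A :: "'a::topological_space set"
  shows "closure (set_power A :: ('b \<Rightarrow> 'a) set) \<subseteq> set_power (closure A)"
proof -
  have "closed (set_power (closure A) :: ('b \<Rightarrow> 'a) set)"
  proof -
    have "set_power (closure A) = (\<Inter>i. (\<lambda>x::'b \<Rightarrow> 'a. x i) -` closure A)"
      by (auto simp: set_power_def)
    moreover have "closed ((\<lambda>x::'b \<Rightarrow> 'a. x i) -` closure A)" for i
      by (intro closed_vimage closed_closure continuous_on_product_coordinates)
    ultimately show ?thesis by auto
  qed
  then show ?thesis
    by (intro closure_minimal) (auto simp: set_power_def intro: closure_subset[THEN subsetD])
qed

lemma open_set_power: "open A \<Longrightarrow> open (set_power A :: ('k::finite \<Rightarrow> 'a::topological_space) set)"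
proof -
  assume "open A"
  have "set_power A = (\<Inter>i. (\<lambda>x::'k \<Rightarrow> 'a. x i) -` A)"
    by (auto simp: set_power_def)
  moreover have "open ((\<lambda>x::'k \<Rightarrow> 'a. x i) -` A)" for i
    by (intro open_vimage \<open>open A\<close> continuous_on_product_coordinates)
  ultimately show ?thesis by auto
qed

lemma set_power_borel [measurable]:
  assumes [measurable]: "A \<in> sets borel"
  shows "(set_power A :: ('k::finite \<Rightarrow> 'a::topological_space) set) \<in> sets borel"
proof -
  have [measurable]: "(\<lambda>x::'k \<Rightarrow> 'a. x i) \<in> borel_measurable borel" for i
    by (intro borel_measurable_continuous_onI continuous_on_product_coordinates)
  have "set_power A = (\<Inter>i. (\<lambda>x::'k \<Rightarrow> 'a. x i) -` A)"
    by (auto simp: set_power_def)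
  moreover have "(\<lambda>x::'k \<Rightarrow> 'a. x i) -` A \<in> sets borel" for i
    using measurable_sets[of "\<lambda>x::'k \<Rightarrow> 'a. x i" borel borel A] by auto
  ultimately show ?thesis by auto
qed

lemma sets_dirac_sum [simp, measurable_cong]: "sets (dirac_sum I x) = sets borel"
  and space_dirac_sum [simp]: "space (dirac_sum I x) = UNIV"
  by (auto simp: dirac_sum_def)

lemma emeasure_dirac_sum:
  "A \<in> sets borel \<Longrightarrow> emeasure (dirac_sum I x) A = emeasure (count_space I) {i\<in>I. x i \<in> A}"
  unfolding dirac_sum_def by (subst emeasure_distr) (auto intro!: arg_cong2[where f=emeasure])

lemma emeasure_dirac_sum_finite:
  "A \<in> sets borel \<Longrightarrow> finite I \<Longrightarrow> emeasure (dirac_sum I x) A = of_nat (card {i\<in>I. x i \<in> A})"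
  by (subst emeasure_dirac_sum) (auto simp: emeasure_count_space_finite)

lemma nn_integral_dirac_sum:
  "f \<in> borel_measurable borel \<Longrightarrow> (\<integral>\<^sup>+y. f y \<partial>dirac_sum I x) = (\<integral>\<^sup>+i. f (x i) \<partial>count_space I)"
  unfolding dirac_sum_def by (subst nn_integral_distr) auto

lemma integral_dirac_sum:
  fixes f :: "'a::topological_space \<Rightarrow> real"
  assumes "f \<in> borel_measurable borel" "finite I"
  shows "(\<integral>y. f y \<partial>dirac_sum I x) = (\<Sum>i\<in>I. f (x i))"
  unfolding dirac_sum_def using assms
  by (subst integral_distr) (auto simp: lebesgue_integral_count_space_finite)

section \<open>Ideals with a countable open base\<close>

locale based_ideal =
  fixes \<X> :: "'a::polish_space set set" and U :: "nat \<Rightarrow> 'a set"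
  assumes ideal: "ideal_on euclidean \<X>"
    and top_consistent: "topologically_consistent euclidean \<X>"
    and open_base: "countable_open_base euclidean \<X> U"
begin

abbreviation carrier_set :: "'a set" where "carrier_set \<equiv> \<Union>\<X>"

abbreviation configs :: "'a measure set" where "configs \<equiv> counting_measures \<X>"

text \<open>The base itself need not be increasing; the windows are, and still exhaust the ideal.\<close>
definition window :: "nat \<Rightarrow> 'a set" where "window n = (\<Union>i\<le>n. U i)"

lemma ideal_subset: "A \<in> \<X> \<Longrightarrow> B \<subseteq> A \<Longrightarrow> B \<in> \<X>"
  and ideal_Un: "A \<in> \<X> \<Longrightarrow> B \<in> \<X> \<Longrightarrow> A \<union> B \<in> \<X>"
  and ideal_empty [simp]: "{} \<in> \<X>"
  using ideal by (auto simp: ideal_on_def)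

lemma ideal_finite_UN: "finite I \<Longrightarrow> (\<And>i. i \<in> I \<Longrightarrow> A i \<in> \<X>) \<Longrightarrow> (\<Union>i\<in>I. A i) \<in> \<X>"
  by (induction I rule: finite_induct) (auto intro: ideal_Un)

lemma ideal_closure: "B \<in> \<X> \<Longrightarrow> closure B \<in> \<X>"
  using top_consistent closure_minimal
  by (metis closed_closedin ideal_subset topologically_consistent_def)

lemma open_U [simp]: "open (U i)" and U_in_ideal [simp]: "U i \<in> \<X>"
  and ideal_base: "B \<in> \<X> \<Longrightarrow> \<exists>i. B \<subseteq> U i"
  using open_base by (auto simp: countable_open_base_def)

lemma carrier_set_eq: "carrier_set = (\<Union>i. U i)"
  using ideal_base U_in_ideal by blast

lemma open_carrier_set [simp]: "open carrier_set"
  unfolding carrier_set_eq by auto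

lemma open_window [simp]: "open (window n)" and window_in_ideal [simp]: "window n \<in> \<X>"
  unfolding window_def by (auto intro!: ideal_finite_UN)

lemma window_mono: "m \<le> n \<Longrightarrow> window m \<subseteq> window n"
  unfolding window_def by force

lemma ideal_window:
  assumes "B \<in> \<X>" shows "\<exists>n. B \<subseteq> window n"
proof -
  obtain i where "B \<subseteq> U i" using ideal_base[OF assms] by auto
  then have "B \<subseteq> window i" by (force simp: window_def)
  then show ?thesis ..
qed

lemma finite_subset_base:
  assumes "finite F" "F \<subseteq> carrier_set" shows "\<exists>i. F \<subseteq> U i"
proof -
  have "\<exists>A\<in>\<X>. x \<in> A" if "x \<in> F" for x using assms that by auto
  then obtain A where "\<And>x. x \<in> F \<Longrightarrow> A x \<in> \<X> \<and> x \<in> A x" by metis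
  then have "(\<Union>x\<in>F. A x) \<in> \<X>" "F \<subseteq> (\<Union>x\<in>F. A x)"
    using assms by (auto intro!: ideal_finite_UN)
  then show ?thesis using ideal_base by (meson subset_trans)
qed

text \<open>The closed support of a test function lies in the open set \<^term>\<open>\<Union>\<X>\<close>, so its extension by zero
  is continuous on the whole space.\<close>
lemma test_functions_iff:
  "f \<in> ideal_test_functions euclidean \<X> \<longleftrightarrow>
     continuous_on UNIV f \<and> bounded (range f) \<and> closure {x. f x \<noteq> 0} \<in> \<X>"
proof
  assume f: "f \<in> ideal_test_functions euclidean \<X>"
  have z: "\<And>x. x \<notin> carrier_set \<Longrightarrow> f x = 0" and b: "bounded (f ` carrier_set)"
    and c: "continuous_on carrier_set f" and cl: "closure {x \<in> carrier_set. f x \<noteq> 0} \<in> \<X>"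
    using f by (auto simp: ideal_test_functions_def)
  have eq: "{x \<in> carrier_set. f x \<noteq> 0} = {x. f x \<noteq> 0}" using z by auto
  have cl': "closure {x. f x \<noteq> 0} \<in> \<X>" using cl unfolding eq .
  have "range f \<subseteq> insert 0 (f ` carrier_set)" using z by auto
  with b have "bounded (range f)" by (meson bounded_insert bounded_subset)
  moreover have "continuous_on UNIV f"
  proof -
    have "continuous_on (- closure {x. f x \<noteq> 0}) f"
      by (rule continuous_on_eq[of _ "\<lambda>_. 0"]) (use closure_subset[of "{x. f x \<noteq> 0}"] in auto)
    then have "continuous_on (carrier_set \<union> - closure {x. f x \<noteq> 0}) f"
      using c by (intro continuous_on_open_Un) auto
    moreover have "carrier_set \<union> - closure {x. f x \<noteq> 0} = UNIV" using cl' by blast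
    ultimately show ?thesis by simp
  qed
  ultimately show "continuous_on UNIV f \<and> bounded (range f) \<and> closure {x. f x \<noteq> 0} \<in> \<X>"
    using cl' by auto
next
  assume *: "continuous_on UNIV f \<and> bounded (range f) \<and> closure {x. f x \<noteq> 0} \<in> \<X>"
  then have z: "\<And>x. x \<notin> carrier_set \<Longrightarrow> f x = 0" using closure_subset[of "{x. f x \<noteq> 0}"] by blast
  then have eq: "{x \<in> carrier_set. f x \<noteq> 0} = {x. f x \<noteq> 0}" by auto
  have "bounded (f ` carrier_set)" using * by (meson bounded_subset image_mono subset_UNIV)
  then show "f \<in> ideal_test_functions euclidean \<X>"
    using * z eq unfolding ideal_test_functions_def
    by (simp del: Union_iff) (auto intro: continuous_on_subset)
qed

lemma cutoff_function_exists:
  assumes "closed C" "open V" "C \<subseteq> V" "V \<in> \<X>"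
  obtains \<phi> :: "'a \<Rightarrow> real" where "\<phi> \<in> ideal_test_functions euclidean \<X>"
    "\<And>x. 0 \<le> \<phi> x" "\<And>x. \<phi> x \<le> 1" "\<And>x. x \<in> C \<Longrightarrow> \<phi> x = 1" "\<And>x. x \<notin> V \<Longrightarrow> \<phi> x = 0"
proof -
  have "normal_space (euclidean :: 'a topology)"
    by (intro metrizable_imp_normal_space metrizable_space_euclidean)
  then obtain \<phi> where \<phi>: "continuous_map euclidean (top_of_set {0..1::real}) \<phi>"
     "\<phi> ` (- V) \<subseteq> {0}" "\<phi> ` C \<subseteq> {1}"
    using Urysohn_lemma[of euclidean "- V" C "0::real" 1] assms
    by (auto simp: disjnt_def)
  have r: "\<And>x. 0 \<le> \<phi> x \<and> \<phi> x \<le> 1" and c: "continuous_on UNIV \<phi>"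
    using \<phi>(1) by (auto simp: continuous_map_in_subtopology image_subset_iff)
  have "bounded (range \<phi>)" using r by (intro boundedI[of _ 1]) auto
  moreover have "{x. \<phi> x \<noteq> 0} \<subseteq> V" using \<phi>(2) by auto
  then have "closure {x. \<phi> x \<noteq> 0} \<in> \<X>"
    using \<open>V \<in> \<X>\<close> ideal_closure ideal_subset by blast
  ultimately show ?thesis
    using r c \<phi> by (intro that[of \<phi>]) (auto simp: test_functions_iff image_subset_iff)
qed

lemma configsD:
  assumes "m \<in> configs"
  shows "sets m = sets borel" "space m = UNIV"
    "A \<in> \<X> \<Longrightarrow> A \<in> sets borel \<Longrightarrow> emeasure m A < \<infinity>"
    "A \<in> sets borel \<Longrightarrow> A \<inter> carrier_set = {} \<Longrightarrow> emeasure m A = 0"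
    "A \<in> \<X> \<Longrightarrow> A \<in> sets borel \<Longrightarrow> \<exists>n::nat. emeasure m A = of_nat n"
  using assms sets_eq_imp_space_eq[of m borel]
  by (auto simp: counting_measures_def ideal_measures_def)

lemma configsI:
  assumes "sets m = sets borel"
    "\<And>A. A \<in> sets borel \<Longrightarrow> A \<inter> carrier_set = {} \<Longrightarrow> emeasure m A = 0"
    "\<And>A. A \<in> \<X> \<Longrightarrow> A \<in> sets borel \<Longrightarrow> \<exists>n::nat. emeasure m A = of_nat n"
  shows "m \<in> configs"
  using assms unfolding counting_measures_def ideal_measures_def
  by (force simp: less_top[symmetric])

lemma dirac_sum_in_configs_iff:
  fixes x :: "'k::finite \<Rightarrow> 'a"
  shows "dirac_sum UNIV x \<in> configs \<longleftrightarrow> x \<in> set_power carrier_set"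
proof
  assume "dirac_sum UNIV x \<in> configs"
  then have "emeasure (dirac_sum UNIV x) (- carrier_set) = 0"
    by (rule configsD) auto
  then show "x \<in> set_power carrier_set"
    by (subst (asm) emeasure_dirac_sum_finite) (auto simp: set_power_def)
next
  assume "x \<in> set_power carrier_set"
  then show "dirac_sum UNIV x \<in> configs"
    by (intro configsI) (auto simp: emeasure_dirac_sum_finite set_power_def)
qed

end

section \<open>Borel sets of a topology\<close>

lemma space_borel_on [simp]: "space (borel_on E) = topspace E"
  unfolding borel_on_def by (intro space_measure_of) (auto dest: openin_subset)

lemma sets_borel_on: "sets (borel_on E) = sigma_sets (topspace E) {V. openin E V}"
  unfolding borel_on_def by (intro sets_measure_of) (auto dest: openin_subset)

lemma openin_in_sets_borel_on: "openin E V \<Longrightarrow> V \<in> sets (borel_on E)"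
  unfolding sets_borel_on by auto

lemma measurable_borel_on_continuous_map:
  assumes "continuous_map E F f"
  shows "f \<in> measurable (borel_on E) (borel_on F)"
  unfolding borel_on_def[of F]
proof (rule measurable_measure_of)
  show "{V. openin F V} \<subseteq> Pow (topspace F)" by (auto dest: openin_subset)
  show "f \<in> space (borel_on E) \<rightarrow> topspace F"
    using assms by (auto simp: continuous_map_def)
  show "f -` V \<inter> space (borel_on E) \<in> sets (borel_on E)" if "V \<in> {V. openin F V}" for V
    using openin_continuous_map_preimage[OF assms, of V] that
    by (auto intro!: openin_in_sets_borel_on simp: vimage_def Int_def conj_commute)
qed

section \<open>Restriction and atoms of configurations\<close>

definition restrict_config :: "'a set \<Rightarrow> 'a measure \<Rightarrow> 'a measure" where
  "restrict_config B m = density m (indicator B)"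

lemma sets_restrict_config [simp]: "sets (restrict_config B m) = sets m"
  by (simp add: restrict_config_def)

lemma emeasure_restrict_config:
  "A \<in> sets m \<Longrightarrow> B \<in> sets m \<Longrightarrow> emeasure (restrict_config B m) A = emeasure m (A \<inter> B)"
  unfolding restrict_config_def
  by (subst emeasure_density) (auto simp: indicator_inter_arith[symmetric] Int_commute)

lemma integral_restrict_config:
  fixes f :: "'a \<Rightarrow> real"
  assumes [measurable]: "f \<in> borel_measurable m" "B \<in> sets m" and "{x. f x \<noteq> 0} \<subseteq> B"
  shows "(\<integral>x. f x \<partial>restrict_config B m) = (\<integral>x. f x \<partial>m)"
proof -
  have "density m (indicator B) = density m (\<lambda>x. ennreal (indicator B x))"
    by (simp add: ennreal_indicator)
  then have "(\<integral>x. f x \<partial>restrict_config B m) = (\<integral>x. indicator B x *\<^sub>R f x \<partial>m)"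
    unfolding restrict_config_def by (simp add: integral_density)
  also have "\<dots> = (\<integral>x. f x \<partial>m)"
    using assms(3) by (intro Bochner_Integration.integral_cong) (auto simp: indicator_def)
  finally show ?thesis .
qed

text \<open>If the points in \<open>B\<close> are listed by \<open>y\<close> and all of them lie in \<open>C \<subseteq> B\<close>, then \<open>y\<close> also lists the
  points in \<open>C\<close>.  This passes from the window in which the Janossy measure is taken to the smaller window
  on which the approximating functions live.\<close>
lemma restrict_config_listingD:
  fixes y :: "'k::finite \<Rightarrow> 'a::t2_space"
  assumes eq: "restrict_config B m = dirac_sum UNIV y"
    and m: "sets m = sets borel" and [measurable]: "B \<in> sets borel"
  shows "y \<in> set_power B"
    "C \<in> sets borel \<Longrightarrow> C \<subseteq> B \<Longrightarrow> y \<in> set_power C \<Longrightarrow> restrict_config C m = dirac_sum UNIV y"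
proof -
  have e: "emeasure m (A \<inter> B) = of_nat (card {i. y i \<in> A})" if "A \<in> sets borel" for A
    using emeasure_restrict_config[of A m B] that m
    by (simp add: eq emeasure_dirac_sum_finite)
  from e[of "- B"] show "y \<in> set_power B" by (auto simp: set_power_def)
  show "restrict_config C m = dirac_sum UNIV y"
    if [measurable]: "C \<in> sets borel" and C: "C \<subseteq> B" "y \<in> set_power C"
  proof (rule measure_eqI)
    show "sets (restrict_config C m) = sets (dirac_sum UNIV y)" by (simp add: m)
    fix A assume "A \<in> sets (restrict_config C m)"
    then have [measurable]: "A \<in> sets borel" by (simp add: m)
    have "emeasure (restrict_config C m) A = emeasure m ((A \<inter> C) \<inter> B)"
      using C by (subst emeasure_restrict_config) (auto simp: m intro!: arg_cong[where f="emeasure m"])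
    also have "\<dots> = of_nat (card {i. y i \<in> A})"
      using C(2) by (subst e) (auto simp: set_power_def)
    finally show "emeasure (restrict_config C m) A = emeasure (dirac_sum UNIV y) A"
      by (simp add: emeasure_dirac_sum_finite)
  qed
qed

context based_ideal begin

text \<open>By the Lindelof property, some point has only neighbourhoods that meet a given set of positive mass in
  positive mass.  These masses are integers, hence at least 1; so is their limit, and the point is an atom in the set.\<close>
lemma null_if_no_atoms:
  assumes m: "m \<in> configs" and A: "A \<in> \<X>" "A \<in> sets borel"
    and no: "\<And>x. x \<in> A \<Longrightarrow> emeasure m {x} = 0"
  shows "emeasure m A = 0"
proof (rule ccontr)
  assume pos: "emeasure m A \<noteq> 0"
  note [simp] = configsD(1)[OF m] and [measurable] = A(2)
  have "\<exists>x. \<forall>V. open V \<longrightarrow> x \<in> V \<longrightarrow> emeasure m (A \<inter> V) \<noteq> 0"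
  proof (rule ccontr)
    assume "\<not> ?thesis"
    then have cov: "\<Union>{V. open V \<and> emeasure m (A \<inter> V) = 0} = UNIV" by auto
    obtain F where F: "F \<subseteq> {V. open V \<and> emeasure m (A \<inter> V) = 0}" "countable F"
        "\<Union>F = \<Union>{V. open V \<and> emeasure m (A \<inter> V) = 0}"
      using Lindelof[of "{V. open V \<and> emeasure m (A \<inter> V) = 0}"] by auto
    have "(\<Union>V\<in>F. A \<inter> V) \<in> null_sets m"
      using F by (intro null_sets_UN') (auto intro!: null_setsI)
    moreover have "(\<Union>V\<in>F. A \<inter> V) = A" using F(3) cov by auto
    ultimately show False using pos by auto
  qed
  then obtain x where x: "\<And>V. open V \<Longrightarrow> x \<in> V \<Longrightarrow> emeasure m (A \<inter> V) \<noteq> 0" by auto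
  define D where "D n = A \<inter> ball x (1 / real (Suc n))" for n
  have D[measurable]: "D n \<in> sets borel" and DX: "D n \<in> \<X>" for n
    using A ideal_subset by (auto simp: D_def)
  have ge: "1 \<le> emeasure m (D n)" for n
  proof -
    obtain j :: nat where j: "emeasure m (D n) = of_nat j" using configsD(5)[OF m DX D] by auto
    have "emeasure m (D n) \<noteq> 0" unfolding D_def by (intro x) auto
    then have "1 \<le> j" using j by (cases j) auto
    then show ?thesis
      unfolding j using of_nat_mono[of 1 j, where 'a=ennreal] by simp
  qed
  have "decseq D"
    unfolding D_def decseq_def by (intro allI impI Int_mono subset_ball order_refl) (auto simp: frac_le)
  moreover have "emeasure m (D n) \<noteq> \<infinity>" for n
    using configsD(3)[OF m DX D] by (metis infinity_ennreal_def less_irrefl)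
  ultimately have "(\<lambda>n. emeasure m (D n)) \<longlonglongrightarrow> emeasure m (\<Inter>n. D n)"
    by (intro Lim_emeasure_decseq) auto
  then have ge': "1 \<le> emeasure m (\<Inter>n. D n)"
    using ge by (intro LIMSEQ_le_const) auto
  have "(\<Inter>n. D n) \<subseteq> A \<inter> {x}"
  proof
    fix z assume z: "z \<in> (\<Inter>n. D n)"
    then have "dist x z < 1 / real (Suc n)" for n by (auto simp: D_def)
    then have "dist x z = 0"
      by (metis nat_approx_posE not_less_iff_gr_or_eq zero_less_dist_iff dist_eq_0_iff)
    then show "z \<in> A \<inter> {x}" using z by (auto simp: D_def)
  qed
  moreover have "emeasure m (A \<inter> {x}) = 0" by (cases "x \<in> A") (auto simp: no)
  ultimately have "emeasure m (\<Inter>n. D n) \<le> 0"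
    by (metis emeasure_mono sets.Int sets.empty_sets A(2) configsD(1)[OF m] borel_singleton)
  then show False using ge' by auto
qed

text \<open>Atoms have integer mass, and only finitely many lie in each base set; there is no mass outside the
  atoms.  Each atom is repeated according to its mass, and the resulting countable index set is coded by
  natural numbers.\<close>
lemma config_eq_dirac_sum:
  assumes m: "m \<in> configs"
  shows "\<exists>(I::nat set) x. m = dirac_sum I x"
proof -
  note [simp] = configsD(1)[OF m]
  define At where "At = {x. emeasure m {x} \<noteq> 0}"
  have Atc: "At \<subseteq> carrier_set"
  proof
    fix x assume "x \<in> At"
    then show "x \<in> carrier_set"
      using configsD(4)[OF m, of "{x}"] unfolding At_def by (cases "x \<in> carrier_set") auto
  qed
  have "\<exists>n::nat. emeasure m {x} = of_nat n" for x
  proof (cases "x \<in> carrier_set")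
    case True
    then show ?thesis using configsD(5)[OF m, of "{x}"] ideal_subset by auto
  next
    case False
    then show ?thesis using configsD(4)[OF m, of "{x}"] by (auto intro: exI[of _ 0])
  qed
  then obtain w :: "'a \<Rightarrow> nat" where w: "\<And>x. emeasure m {x} = of_nat (w x)" by metis
  have finU: "finite (At \<inter> U i)" for i
  proof -
    obtain n :: nat where n: "emeasure m (U i) = of_nat n" using configsD(5)[OF m, of "U i"] by auto
    show ?thesis
    proof (rule conjunct1[OF finite_if_finite_subsets_card_bdd])
      fix F assume F: "F \<subseteq> At \<inter> U i" "finite F"
      have "of_nat (card F) = (\<Sum>x\<in>F. 1 :: ennreal)" by simp
      also have "\<dots> \<le> (\<Sum>x\<in>F. emeasure m {x})"
      proof (rule sum_mono)
        fix x assume "x \<in> F"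
        then have "w x \<noteq> 0" using F w[of x] by (auto simp: At_def)
        then show "1 \<le> emeasure m {x}"
          unfolding w using of_nat_mono[of 1 "w x", where 'a=ennreal] by simp
      qed
      also have "\<dots> = emeasure m F"
        using F by (intro emeasure_eq_sum_singleton[symmetric]) auto
      also have "\<dots> \<le> of_nat n" unfolding n[symmetric] using F by (intro emeasure_mono) auto
      finally show "card F \<le> n" by simp
    qed
  qed
  have "countable (\<Union>i. At \<inter> U i)" by (rule countable_UN) (simp_all add: countable_finite[OF finU])
  moreover have "At \<subseteq> (\<Union>i. At \<inter> U i)" using Atc unfolding carrier_set_eq by blast
  ultimately have cAt: "countable At" using countable_subset by blast
  have [measurable]: "At \<in> sets borel"
    by (rule sets.countable[OF _ cAt]) simp
  define K where "K = (SIGMA x:At. {..<w x})"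
  have cK: "countable K" unfolding K_def using cAt by (intro countable_SIGMA) simp_all
  have inj: "inj_on (to_nat_on K) K" using cK by (rule inj_on_to_nat_on)
  have "m = dirac_sum (to_nat_on K ` K) (fst \<circ> from_nat_into K)"
  proof (rule measure_eqI)
    show "sets m = sets (dirac_sum (to_nat_on K ` K) (fst \<circ> from_nat_into K))" by simp
    fix C assume "C \<in> sets m"
    then have [measurable]: "C \<in> sets borel" by simp
    \<comment> \<open>the part of \<open>C\<close> outside the atoms, cut into pieces on which there is no atom\<close>
    define N where "N = (\<Union>i. C \<inter> U i - At) \<union> (C - carrier_set - At)"
    have eqC: "C \<inter> At \<union> N = C"
      unfolding N_def carrier_set_eq by blast
    have "emeasure m (C \<inter> U i - At) = 0" for i
    proof (rule null_if_no_atoms[OF m])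
      show "C \<inter> U i - At \<in> \<X>" by (rule ideal_subset[of "U i"]) auto
    qed (auto simp: At_def[symmetric], simp add: At_def)
    then have "(\<Union>i. C \<inter> U i - At) \<in> null_sets m"
      by (intro null_sets_UN) auto
    moreover have "C - carrier_set - At \<in> null_sets m"
      using configsD(4)[OF m, of "C - carrier_set - At"] open_carrier_set by (auto simp: null_sets_def)
    ultimately have "N \<in> null_sets m"
      unfolding N_def by (rule null_sets.Un)
    then have "emeasure m C = emeasure m (C \<inter> At)"
      using emeasure_Un_null_set[of "C \<inter> At" m N] by (simp add: eqC)
    also have "\<dots> = (\<integral>\<^sup>+x. emeasure m {x} \<partial>count_space (C \<inter> At))"
      using cAt by (intro emeasure_countable_singleton) auto
    also have "\<dots> = (\<integral>\<^sup>+x. emeasure (count_space UNIV) ({x} \<times> {..<w x}) \<partial>count_space (C \<inter> At))"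
      by (intro nn_integral_cong) (simp add: w emeasure_count_space_finite)
    also have "\<dots> = emeasure (count_space UNIV) (\<Union>x\<in>C \<inter> At. {x} \<times> {..<w x})"
      using cAt by (intro emeasure_UN_countable[symmetric]) (auto simp: disjoint_family_on_def)
    also have "(\<Union>x\<in>C \<inter> At. {x} \<times> {..<w x}) = {p\<in>K. fst p \<in> C}"
      by (auto simp: K_def)
    also have "emeasure (count_space UNIV) \<dots> = emeasure (count_space UNIV) (to_nat_on K ` {p\<in>K. fst p \<in> C})"
    proof -
      have i: "inj_on (to_nat_on K) {p\<in>K. fst p \<in> C}" by (rule inj_on_subset[OF inj]) auto
      show ?thesis using finite_image_iff[OF i] card_image[OF i] by (simp add: emeasure_count_space)
    qed
    also have "to_nat_on K ` {p\<in>K. fst p \<in> C}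
       = {i \<in> to_nat_on K ` K. (fst \<circ> from_nat_into K) i \<in> C}"
      using cK by auto
    also have "emeasure (count_space UNIV) \<dots> = emeasure (count_space (to_nat_on K ` K)) \<dots>"
      by (auto simp: emeasure_count_space)
    also have "\<dots> = emeasure (dirac_sum (to_nat_on K ` K) (fst \<circ> from_nat_into K)) C"
      by (simp add: emeasure_dirac_sum)
    finally show "emeasure m C = emeasure (dirac_sum (to_nat_on K ` K) (fst \<circ> from_nat_into K)) C" .
  qed
  then show ?thesis by blast
qed

lemma test_function_integrable:
  assumes \<phi>: "\<phi> \<in> ideal_test_functions euclidean \<X>" and m: "m \<in> configs"
  shows "integrable m \<phi>"
proof -
  have cl: "closure {x. \<phi> x \<noteq> 0} \<in> \<X>" and "bounded (range \<phi>)" and c: "continuous_on UNIV \<phi>"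
    using \<phi> by (auto simp: test_functions_iff)
  then obtain K where K: "\<And>x. \<bar>\<phi> x\<bar> \<le> K" by (auto simp: bounded_iff)
  show ?thesis
  proof (rule integrableI_bounded_set[where A="closure {x. \<phi> x \<noteq> 0}" and B=K])
    show "\<phi> \<in> borel_measurable m"
      using borel_measurable_continuous_onI[OF c] measurable_cong_sets[OF configsD(1)[OF m] refl] by blast
    show "AE x in m. x \<notin> closure {x. \<phi> x \<noteq> 0} \<longrightarrow> \<phi> x = 0"
      using closure_subset[of "{x. \<phi> x \<noteq> 0}"] by auto
  qed (use configsD[OF m] cl K in auto)
qed

lemma test_function_borel_measurable:
  "\<phi> \<in> ideal_test_functions euclidean \<X> \<Longrightarrow> \<phi> \<in> borel_measurable borel"
  by (auto simp: test_functions_iff intro: borel_measurable_continuous_onI)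

lemma integral_le_measure:
  assumes \<phi>: "\<phi> \<in> ideal_test_functions euclidean \<X>" and m: "m \<in> configs"
    and "V \<in> \<X>" "V \<in> sets borel" "\<And>x. \<phi> x \<le> 1" "\<And>x. x \<notin> V \<Longrightarrow> \<phi> x = 0"
  shows "(\<integral>x. \<phi> x \<partial>m) \<le> measure m V"
proof -
  have "(\<integral>x. \<phi> x \<partial>m) \<le> (\<integral>x. indicator V x \<partial>m)"
    using test_function_integrable[OF \<phi> m] assms configsD[OF m]
    by (intro integral_mono integrable_real_indicator) (auto simp: indicator_def)
  then show ?thesis using assms configsD[OF m] by simp
qed

lemma measure_le_integral:
  assumes \<phi>: "\<phi> \<in> ideal_test_functions euclidean \<X>" and m: "m \<in> configs"
    and "C \<in> \<X>" "C \<in> sets borel" "\<And>x. 0 \<le> \<phi> x" "\<And>x. x \<in> C \<Longrightarrow> \<phi> x = 1"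
  shows "measure m C \<le> (\<integral>x. \<phi> x \<partial>m)"
proof -
  have "(\<integral>x. indicator C x \<partial>m) \<le> (\<integral>x. \<phi> x \<partial>m)"
    using test_function_integrable[OF \<phi> m] assms configsD[OF m]
    by (intro integral_mono integrable_real_indicator) (auto simp: indicator_def)
  then show ?thesis using assms configsD[OF m] by simp
qed

section \<open>Vague topology on configurations\<close>

lemma topspace_counting_space [simp]: "topspace (counting_space \<X>) = configs"
proof -
  have "(\<lambda>x. 0) \<in> ideal_test_functions euclidean \<X>"
    by (auto simp: test_functions_iff)
  then have "{m \<in> ideal_measures euclidean \<X>. (\<integral>x. (\<lambda>x. 0) x \<partial>m) \<in> UNIV} \<subseteq> topspace (vague_topology euclidean \<X>)"
    unfolding vague_topology_def topology_generated_by_topspace by blast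
  then have "configs \<subseteq> topspace (vague_topology euclidean \<X>)"
    by (auto simp: counting_measures_def)
  then show ?thesis by (auto simp: counting_space_def)
qed

lemma openin_integral:
  assumes "\<phi> \<in> ideal_test_functions euclidean \<X>" "open V"
  shows "openin (counting_space \<X>) {m \<in> configs. (\<integral>x. \<phi> x \<partial>m) \<in> V}"
proof -
  have "openin (vague_topology euclidean \<X>) {m \<in> ideal_measures euclidean \<X>. (\<integral>x. \<phi> x \<partial>m) \<in> V}"
    unfolding vague_topology_def using assms by (intro topology_generated_by_Basis) blast
  then have "openin (counting_space \<X>) (configs \<inter> {m \<in> ideal_measures euclidean \<X>. (\<integral>x. \<phi> x \<partial>m) \<in> V})"
    unfolding counting_space_def by (rule openin_subtopology_Int2)
  moreover have "configs \<inter> {m \<in> ideal_measures euclidean \<X>. (\<integral>x. \<phi> x \<partial>m) \<in> V}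
     = {m \<in> configs. (\<integral>x. \<phi> x \<partial>m) \<in> V}"
    by (auto simp: counting_measures_def)
  ultimately show ?thesis by simp
qed

text \<open>The half-integer threshold turns the closed condition into an open one for integer-valued masses.\<close>
lemma emeasure_ge_iff_measure:
  assumes "m \<in> configs" "V \<in> \<X>" "V \<in> sets borel"
  shows "of_nat n \<le> emeasure m V \<longleftrightarrow> real n - 1 / 2 < measure m V"
proof -
  obtain j :: nat where j: "emeasure m V = of_nat j" using configsD(5)[OF assms] by auto
  then have "measure m V = real j" by (simp add: measure_def)
  then show ?thesis unfolding j by simp linarith
qed

text \<open>The points of \<open>m\<^sub>0\<close> in \<open>V\<close> form a finite, hence closed, set \<open>C\<close> that carries the whole mass
  of \<open>V\<close>.  A cutoff function between \<open>C\<close> and \<open>V\<close> detects this mass by an integral that is continuous in \<open>m\<close>.\<close>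
lemma openin_emeasure_ge:
  assumes V: "open V" "V \<in> \<X>"
  shows "openin (counting_space \<X>) {m \<in> configs. of_nat n \<le> emeasure m V}"
proof (subst openin_subopen, intro ballI)
  fix m0 assume "m0 \<in> {m \<in> configs. of_nat n \<le> emeasure m V}"
  then have m0: "m0 \<in> configs" and n: "of_nat n \<le> emeasure m0 V" by auto
  obtain I :: "nat set" and x where Ix: "m0 = dirac_sum I x" using config_eq_dirac_sum[OF m0] by auto
  have Vm[measurable]: "V \<in> sets borel" using V by auto
  define C where "C = x ` {i\<in>I. x i \<in> V}"
  have "emeasure (count_space I) {i\<in>I. x i \<in> V} < \<infinity>"
    using configsD(3)[OF m0 V(2) Vm] by (simp add: Ix emeasure_dirac_sum)
  then have "finite {i\<in>I. x i \<in> V}"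
    by (metis (no_types, lifting) emeasure_count_space_infinite infinity_ennreal_def less_irrefl mem_Collect_eq subsetI)
  then have C: "finite C" "C \<subseteq> V" unfolding C_def by auto
  then have "C \<in> \<X>" using V ideal_subset by auto
  have Cm: "C \<in> sets borel" using C(1) by (intro borel_closed finite_imp_closed)
  have "emeasure m0 C = emeasure m0 V"
    using C unfolding Ix emeasure_dirac_sum[OF Cm] emeasure_dirac_sum[OF Vm]
    by (auto simp: C_def intro!: arg_cong2[where f=emeasure])
  then have "measure m0 C = measure m0 V" by (simp add: measure_def)
  then have mC: "real n - 1 / 2 < measure m0 C" using n emeasure_ge_iff_measure[OF m0 V(2) Vm] by simp
  obtain \<phi> where \<phi>: "\<phi> \<in> ideal_test_functions euclidean \<X>"
    "\<And>x. 0 \<le> \<phi> x" "\<And>x. \<phi> x \<le> 1" "\<And>x. x \<in> C \<Longrightarrow> \<phi> x = 1" "\<And>x. x \<notin> V \<Longrightarrow> \<phi> x = 0"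
    using cutoff_function_exists[of C V] C V by (metis finite_imp_closed)
  define N where "N = {m \<in> configs. (\<integral>x. \<phi> x \<partial>m) \<in> {real n - 1 / 2 <..}}"
  have "openin (counting_space \<X>) N" unfolding N_def by (intro openin_integral \<phi>) auto
  moreover have "m0 \<in> N"
    using mC measure_le_integral[OF \<phi>(1) m0 \<open>C \<in> \<X>\<close> Cm \<phi>(2,4)] m0 by (auto simp: N_def)
  moreover have "N \<subseteq> {m \<in> configs. of_nat n \<le> emeasure m V}"
    using integral_le_measure[OF \<phi>(1) _ V(2) Vm \<phi>(3,5)] emeasure_ge_iff_measure[OF _ V(2) Vm]
    by (fastforce simp: N_def)
  ultimately show "\<exists>N. openin (counting_space \<X>) N \<and> m0 \<in> N \<and> N \<subseteq> {m \<in> configs. of_nat n \<le> emeasure m V}"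
    by blast
qed

text \<open>Intersecting with \<open>V\<close> keeps all masses finite, as the complement step of the Dynkin argument needs.\<close>
lemma measurable_emeasure_config:
  assumes V: "open V" "V \<in> \<X>" and A: "A \<in> sets borel"
  shows "(\<lambda>m. emeasure m (A \<inter> V)) \<in> borel_measurable (borel_on (counting_space \<X>))"
proof -
  have op: "(\<lambda>m. emeasure m W) \<in> borel_measurable (borel_on (counting_space \<X>))"
    if W: "open W" "W \<in> \<X>" for W
  proof (rule borel_measurableI_greater)
    fix c :: ennreal
    have "{m \<in> configs. c < emeasure m W} = (\<Union>n\<in>{n::nat. c < of_nat n}. {m \<in> configs. of_nat n \<le> emeasure m W})"
      using configsD(5)[of _ W] W by (auto intro: less_le_trans) (metis borel_open order_refl)
    also have "\<dots> \<in> sets (borel_on (counting_space \<X>))"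
      using W by (intro sets.countable_UN') (auto intro!: openin_in_sets_borel_on openin_emeasure_ge)
    finally show "{m \<in> space (borel_on (counting_space \<X>)). c < emeasure m W} \<in> sets (borel_on (counting_space \<X>))"
      by simp
  qed
  have "Int_stable {S :: 'a set. open S}" "{S :: 'a set. open S} \<subseteq> Pow UNIV"
    "A \<in> sigma_sets UNIV {S. open S}"
    using A by (auto simp: borel_def Int_stable_def)
  then show ?thesis
  proof (induction rule: sigma_sets_induct_disjoint)
    case (basic A)
    then show ?case using V by (intro op) (auto intro: ideal_subset)
  next
    case empty
    show ?case by simp
  next
    case (compl A)
    then have [measurable]: "A \<in> sets borel" by (simp add: borel_def)
    have [measurable]: "V \<in> sets borel" using V by auto
    have "emeasure m ((UNIV - A) \<inter> V) = emeasure m V - emeasure m (A \<inter> V)" if "m \<in> configs" for m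
    proof -
      have "emeasure m (V - A \<inter> V) = emeasure m V - emeasure m (A \<inter> V)"
        using configsD[OF that] V ideal_subset[of V "A \<inter> V"]
        by (intro emeasure_Diff) (auto simp: less_top)
      moreover have "V - A \<inter> V = (UNIV - A) \<inter> V" by auto
      ultimately show ?thesis by simp
    qed
    moreover have "(\<lambda>m. emeasure m V - emeasure m (A \<inter> V)) \<in> borel_measurable (borel_on (counting_space \<X>))"
      using compl op[OF V] by (intro borel_measurable_minus_ennreal) auto
    ultimately show ?case by (subst measurable_cong) auto
  next
    case (union F)
    then have "range F \<subseteq> sets borel" by (simp add: borel_def)
    then have F: "\<And>i. F i \<in> sets borel" by auto
    have V': "V \<in> sets borel" using V by auto
    have "emeasure m ((\<Union>i. F i) \<inter> V) = (\<Sum>i. emeasure m (F i \<inter> V))" if "m \<in> configs" for m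
    proof -
      have "(\<Sum>i. emeasure m (F i \<inter> V)) = emeasure m (\<Union>i. F i \<inter> V)"
        using union(1) configsD(1)[OF that] F V'
        by (intro suminf_emeasure) (auto simp: disjoint_family_on_def)
      moreover have "(\<Union>i. F i \<inter> V) = (\<Union>i. F i) \<inter> V" by auto
      ultimately show ?thesis by simp
    qed
    moreover have "(\<lambda>m. \<Sum>i. emeasure m (F i \<inter> V)) \<in> borel_measurable (borel_on (counting_space \<X>))"
      using union by (intro borel_measurable_suminf_order) auto
    ultimately show ?case by (subst measurable_cong) auto
  qed
qed

end

section \<open>Counting orderings of the points in a window\<close>

text \<open>An injection on \<open>J\<close> extends to \<open>j\<close> by every value in \<open>S j\<close> that it does not take already; the values
  \<open>\<iota> i \<in> S j\<close> to be excluded are counted by restricting \<open>S i\<close> to \<open>S j\<close>.  The recursion expresses counts of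
  injections by cardinalities of intersections of the sets, whatever listing of points the sets come from.\<close>
lemma card_injections_insert:
  assumes J: "finite J" "j \<notin> J" and S: "\<And>i. i \<in> insert j J \<Longrightarrow> finite (S i)"
  shows "card {\<iota> \<in> PiE (insert j J) S. inj_on \<iota> (insert j J)}
       + (\<Sum>i\<in>J. card {\<iota> \<in> PiE J (S(i := S i \<inter> S j)). inj_on \<iota> J})
       = card {\<iota> \<in> PiE J S. inj_on \<iota> J} * card (S j)"
proof -
  define A where "A = {\<iota> \<in> PiE J S. inj_on \<iota> J}"
  have fA: "finite A"
    by (rule finite_subset[of _ "PiE J S"]) (use J S in \<open>auto simp: A_def intro!: finite_PiE\<close>)
  have sub: "{\<iota> \<in> PiE (insert j J) S. inj_on \<iota> (insert j J)}
      = (\<lambda>(\<iota>, y). \<iota>(j := y)) ` (SIGMA \<iota>:A. S j - \<iota> ` J)" (is "?L = ?R")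
  proof (intro equalityI subsetI)
    fix \<iota> assume \<iota>: "\<iota> \<in> ?L"
    have "restrict \<iota> J \<in> A" using \<iota> by (auto simp: A_def inj_on_def)
    moreover have "\<iota> j \<in> S j - restrict \<iota> J ` J" using \<iota> J by (auto simp: inj_on_def)
    moreover have "\<iota> = (restrict \<iota> J)(j := \<iota> j)"
      using \<iota> J by (auto simp: fun_eq_iff PiE_def extensional_def)
    ultimately show "\<iota> \<in> ?R" by (force intro!: image_eqI[of _ _ "(restrict \<iota> J, \<iota> j)"])
  next
    fix \<iota> assume "\<iota> \<in> ?R"
    then obtain \<kappa> y where \<kappa>: "\<kappa> \<in> A" "y \<in> S j - \<kappa> ` J" "\<iota> = \<kappa>(j := y)" by auto
    then show "\<iota> \<in> ?L"
      using J by (auto simp: A_def inj_on_def PiE_def extensional_def Pi_def image_iff)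
  qed
  have "inj_on (\<lambda>(\<iota>, y). \<iota>(j := y)) (SIGMA \<iota>:A. S j - \<iota> ` J)"
  proof (rule inj_onI, clarsimp)
    fix \<iota> \<kappa> y z assume *: "\<iota> \<in> A" "\<kappa> \<in> A" "\<iota>(j := y) = \<kappa>(j := z)"
    have "\<iota> i = \<kappa> i" for i
      using fun_cong[OF *(3), of i] *(1,2) J(2) by (cases "i = j") (auto simp: A_def PiE_def extensional_def)
    then show "\<iota> = \<kappa> \<and> y = z" using fun_cong[OF *(3), of j] by auto
  qed
  then have c1: "card ?L = (\<Sum>\<iota>\<in>A. card (S j - \<iota> ` J))"
    unfolding sub using fA S by (subst card_image) auto
  have "(\<Sum>\<iota>\<in>A. card {i\<in>J. \<iota> i \<in> S j}) = (\<Sum>\<iota>\<in>A. \<Sum>i\<in>J. if \<iota> i \<in> S j then 1 else 0)"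
    using J by (intro sum.cong refl) (simp add: sum.If_cases Int_def)
  also have "\<dots> = (\<Sum>i\<in>J. \<Sum>\<iota>\<in>A. if \<iota> i \<in> S j then 1 else 0)"
    by (rule sum.swap)
  also have "\<dots> = (\<Sum>i\<in>J. card {\<iota> \<in> PiE J (S(i := S i \<inter> S j)). inj_on \<iota> J})"
  proof (intro sum.cong refl)
    fix i assume i: "i \<in> J"
    have "(\<Sum>\<iota>\<in>A. if \<iota> i \<in> S j then 1 else 0) = card {\<iota>\<in>A. \<iota> i \<in> S j}"
      using fA by (simp add: sum.If_cases Int_def)
    also have "{\<iota>\<in>A. \<iota> i \<in> S j} = {\<iota> \<in> PiE J (S(i := S i \<inter> S j)). inj_on \<iota> J}"
      using i by (auto simp: A_def PiE_def Pi_def split: if_splits)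
    finally show "(\<Sum>\<iota>\<in>A. if \<iota> i \<in> S j then 1 else 0)
        = card {\<iota> \<in> PiE J (S(i := S i \<inter> S j)). inj_on \<iota> J}" .
  qed
  finally have c2: "(\<Sum>i\<in>J. card {\<iota> \<in> PiE J (S(i := S i \<inter> S j)). inj_on \<iota> J})
      = (\<Sum>\<iota>\<in>A. card {i\<in>J. \<iota> i \<in> S j})" ..
  have c3: "card (S j - \<iota> ` J) + card {i\<in>J. \<iota> i \<in> S j} = card (S j)" if "\<iota> \<in> A" for \<iota>
  proof -
    have "inj_on \<iota> {i\<in>J. \<iota> i \<in> S j}" using that by (auto simp: A_def inj_on_def)
    then have "card {i\<in>J. \<iota> i \<in> S j} = card (\<iota> ` {i\<in>J. \<iota> i \<in> S j})"
      by (simp add: card_image)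
    also have "\<iota> ` {i\<in>J. \<iota> i \<in> S j} = S j \<inter> \<iota> ` J" by auto
    finally have "card {i\<in>J. \<iota> i \<in> S j} = card (S j \<inter> \<iota> ` J)" .
    moreover have "card (S j) = card (S j - \<iota> ` J) + card (S j \<inter> \<iota> ` J)"
      using S[of j] by (subst card_Un_disjoint[symmetric]) (auto intro!: arg_cong[where f=card])
    ultimately show ?thesis by simp
  qed
  have "card ?L + (\<Sum>i\<in>J. card {\<iota> \<in> PiE J (S(i := S i \<inter> S j)). inj_on \<iota> J})
     = (\<Sum>\<iota>\<in>A. card (S j))"
    unfolding c1 c2 sum.distrib[symmetric] using c3 by (intro sum.cong) auto
  then show ?thesis by (simp add: A_def)
qed

text \<open>The listing of atoms that is selected in the definition of the factorial measure.\<close>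
definition listing :: "'a::topological_space measure \<Rightarrow> nat set \<times> (nat \<Rightarrow> 'a)" where
  "listing m = (SOME (I, x). m = dirac_sum I x)"

definition indices_in :: "'a::topological_space measure \<Rightarrow> 'a set \<Rightarrow> nat set" where
  "indices_in m A = {i \<in> fst (listing m). snd (listing m) i \<in> A}"

lemma factorial_measure_listing:
  "factorial_measure m = dirac_sum {\<iota>. inj \<iota> \<and> range \<iota> \<subseteq> fst (listing m)} (\<lambda>\<iota> j. snd (listing m) (\<iota> j))"
  by (simp add: factorial_measure_def listing_def case_prod_beta)

text \<open>If \<open>m\<close> has exactly \<open>k\<close> points in \<open>B\<close>, this is the law of these points in uniformly random order, and
  the zero measure otherwise.  Averaging it over the point process gives the Janossy measure.\<close>
definition ordering_kernel :: "'a set \<Rightarrow> 'a::topological_space measure \<Rightarrow> ('k::finite \<Rightarrow> 'a) measure" where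
  "ordering_kernel B m = density (factorial_measure m)
     (\<lambda>x. indicator {m. emeasure m B = of_nat CARD('k)} m * indicator (set_power B) x / fact CARD('k))"

lemma sets_ordering_kernel [simp]: "sets (ordering_kernel B m) = sets borel"
  by (simp add: ordering_kernel_def factorial_measure_listing)

lemma space_ordering_kernel [simp]: "space (ordering_kernel B m) = UNIV"
  by (simp add: ordering_kernel_def factorial_measure_listing)

context based_ideal begin

lemma config_listing:
  assumes "m \<in> configs" shows "m = dirac_sum (fst (listing m)) (snd (listing m))"
proof -
  have "\<exists>p. case p of (I, x) \<Rightarrow> m = dirac_sum (I :: nat set) x"
    using config_eq_dirac_sum[OF assms] by auto
  then have "case listing m of (I, x) \<Rightarrow> m = dirac_sum I x"
    unfolding listing_def by (rule someI_ex)
  then show ?thesis by (simp add: case_prod_beta)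
qed

lemma indices_in:
  assumes m: "m \<in> configs" and A: "A \<in> \<X>" "A \<in> sets borel"
  shows "finite (indices_in m A)" "emeasure m A = of_nat (card (indices_in m A))"
proof -
  have e: "emeasure m A = emeasure (count_space (fst (listing m))) (indices_in m A)"
    using A by (subst config_listing[OF m]) (simp add: emeasure_dirac_sum indices_in_def)
  have s: "indices_in m A \<subseteq> fst (listing m)" by (auto simp: indices_in_def)
  show f: "finite (indices_in m A)"
    using e configsD(3)[OF m A] s by (metis emeasure_count_space_infinite infinity_ennreal_def less_irrefl)
  then show "emeasure m A = of_nat (card (indices_in m A))"
    unfolding e by (rule emeasure_count_space_finite[OF s])
qed

text \<open>Although the listing of a configuration is an arbitrary choice, the recursion reduces the number
  of injections to values \<open>m(A)\<close>, which depend measurably on \<open>m\<close>.\<close>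
lemma measurable_card_injections:
  assumes V: "open V" "V \<in> \<X>" and "finite J" "\<And>j. j \<in> J \<Longrightarrow> A j \<in> sets borel \<and> A j \<subseteq> V"
  shows "(\<lambda>m. real (card {\<iota> \<in> PiE J (\<lambda>j. indices_in m (A j)). inj_on \<iota> J}))
     \<in> borel_measurable (borel_on (counting_space \<X>))"
  using assms(3,4)
proof (induction J arbitrary: A rule: finite_induct)
  case empty
  then show ?case by simp
next
  case (insert j J)
  note AV = insert.prems
  have fin: "finite (indices_in m (A i))" if "m \<in> configs" "i \<in> insert j J" for m i
    using AV[OF that(2)] V by (intro indices_in[OF that(1)]) (auto intro: ideal_subset)
  have int: "indices_in m (A i) \<inter> indices_in m (A j) = indices_in m (A i \<inter> A j)" for m i
    by (auto simp: indices_in_def)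
  have eq: "real (card {\<iota> \<in> PiE (insert j J) (\<lambda>j. indices_in m (A j)). inj_on \<iota> (insert j J)}) =
      real (card {\<iota> \<in> PiE J (\<lambda>j. indices_in m (A j)). inj_on \<iota> J}) * enn2real (emeasure m (A j \<inter> V))
      - (\<Sum>i\<in>J. real (card {\<iota> \<in> PiE J (\<lambda>l. indices_in m ((A(i := A i \<inter> A j)) l)). inj_on \<iota> J}))"
    if m: "m \<in> configs" for m
  proof -
    have "A j \<inter> V = A j" using AV[of j] by auto
    moreover have "emeasure m (A j) = of_nat (card (indices_in m (A j)))"
      using AV[of j] V by (intro indices_in[OF m]) (auto intro: ideal_subset)
    ultimately have c: "enn2real (emeasure m (A j \<inter> V)) = real (card (indices_in m (A j)))" by simp
    have f: "(\<lambda>l. indices_in m ((A(i := A i \<inter> A j)) l))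
        = (\<lambda>j. indices_in m (A j))(i := indices_in m (A i) \<inter> indices_in m (A j))" for i
      by (auto simp: fun_eq_iff int)
    have "card {\<iota> \<in> PiE (insert j J) (\<lambda>j. indices_in m (A j)). inj_on \<iota> (insert j J)}
       + (\<Sum>i\<in>J. card {\<iota> \<in> PiE J (\<lambda>l. indices_in m ((A(i := A i \<inter> A j)) l)). inj_on \<iota> J})
       = card {\<iota> \<in> PiE J (\<lambda>j. indices_in m (A j)). inj_on \<iota> J} * card (indices_in m (A j))"
      unfolding f by (rule card_injections_insert) (use insert fin[OF m] in auto)
    from arg_cong[OF this, of real] show ?thesis unfolding c by simp
  qed
  have "(\<lambda>m. real (card {\<iota> \<in> PiE J (\<lambda>j. indices_in m (A j)). inj_on \<iota> J}) * enn2real (emeasure m (A j \<inter> V))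
      - (\<Sum>i\<in>J. real (card {\<iota> \<in> PiE J (\<lambda>l. indices_in m ((A(i := A i \<inter> A j)) l)). inj_on \<iota> J})))
      \<in> borel_measurable (borel_on (counting_space \<X>))"
    using AV by (intro borel_measurable_diff borel_measurable_times borel_measurable_sum
        insert.IH borel_measurable_enn2real measurable_emeasure_config V) auto
  then show ?case by (subst measurable_cong[OF eq]) auto
qed

lemma ordering_kernel_sum:
  fixes h :: "('k::finite \<Rightarrow> 'a) \<Rightarrow> ennreal"
  assumes m: "m \<in> configs" and V: "V \<in> \<X>" "V \<in> sets borel" and h[measurable]: "h \<in> borel_measurable borel"
  shows "(\<integral>\<^sup>+x. h x \<partial>ordering_kernel V m) = (if emeasure m V = of_nat CARD('k)
    then (\<Sum>\<iota> | inj \<iota> \<and> range \<iota> \<subseteq> indices_in m V. h (\<lambda>j. snd (listing m) (\<iota> j))) / fact CARD('k) else 0)"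
proof -
  let ?I = "{\<iota> :: 'k \<Rightarrow> nat. inj \<iota> \<and> range \<iota> \<subseteq> fst (listing m)}"
  let ?S = "{\<iota> :: 'k \<Rightarrow> nat. inj \<iota> \<and> range \<iota> \<subseteq> indices_in m V}"
  let ?y = "\<lambda>\<iota> (j::'k). snd (listing m) (\<iota> j)"
  define c :: ennreal where "c = indicator {m. emeasure m V = of_nat CARD('k)} m / fact CARD('k)"
  note [measurable] = V(2)
  have "finite {\<iota> :: 'k \<Rightarrow> nat. \<iota> \<in> UNIV \<rightarrow>\<^sub>E indices_in m V}"
    using indices_in(1)[OF m V] by (auto intro: finite_PiE)
  then have fS: "finite ?S" by (rule finite_subset[rotated]) auto
  have "(\<integral>\<^sup>+x. h x \<partial>ordering_kernel V m)
      = (\<integral>\<^sup>+x. (indicator {m. emeasure m V = of_nat CARD('k)} m * indicator (set_power V) x / fact CARD('k)) * h x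
          \<partial>factorial_measure m)"
    unfolding ordering_kernel_def factorial_measure_listing
    by (subst nn_integral_density) auto
  also have "\<dots> = (\<integral>\<^sup>+x. c * (indicator (set_power V) x * h x) \<partial>factorial_measure m)"
    by (intro nn_integral_cong) (simp add: c_def divide_ennreal_def ac_simps)
  also have "\<dots> = (\<integral>\<^sup>+\<iota>. c * (indicator (set_power V) (?y \<iota>) * h (?y \<iota>)) \<partial>count_space ?I)"
    unfolding factorial_measure_listing by (rule nn_integral_dirac_sum) measurable
  also have "\<dots> = c * (\<integral>\<^sup>+\<iota>. indicator (set_power V) (?y \<iota>) * h (?y \<iota>) \<partial>count_space ?I)"
    by (rule nn_integral_cmult) auto
  also have "(\<integral>\<^sup>+\<iota>. indicator (set_power V) (?y \<iota>) * h (?y \<iota>) \<partial>count_space ?I)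
      = (\<integral>\<^sup>+\<iota>. indicator (set_power V) (?y \<iota>) * h (?y \<iota>) \<partial>count_space ?S)"
    by (rule nn_integral_count_space_eq) (auto simp: indices_in_def set_power_def indicator_def)
  also have "\<dots> = (\<Sum>\<iota>\<in>?S. indicator (set_power V) (?y \<iota>) * h (?y \<iota>))"
    by (rule nn_integral_count_space_finite[OF fS])
  also have "\<dots> = (\<Sum>\<iota>\<in>?S. h (?y \<iota>))"
    by (intro sum.cong refl) (auto simp: indices_in_def set_power_def indicator_def)
  finally show ?thesis
    by (simp add: c_def indicator_def divide_ennreal_def ac_simps)
qed

lemma card_orderings:
  assumes m: "m \<in> configs" and V: "V \<in> \<X>" "V \<in> sets borel" and "emeasure m V = of_nat CARD('k::finite)"
  shows "card {\<iota> :: 'k \<Rightarrow> nat. inj \<iota> \<and> range \<iota> \<subseteq> indices_in m V} = fact CARD('k)"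
    and "finite {\<iota> :: 'k \<Rightarrow> nat. inj \<iota> \<and> range \<iota> \<subseteq> indices_in m V}"
proof -
  have c: "card (indices_in m V) = CARD('k)" using indices_in(2)[OF m V] assms(4) by simp
  have eq: "{\<iota> :: 'k \<Rightarrow> nat. inj \<iota> \<and> range \<iota> \<subseteq> indices_in m V} = {\<iota> \<in> UNIV \<rightarrow>\<^sub>E indices_in m V. inj_on \<iota> UNIV}"
    by auto
  show k: "card {\<iota> :: 'k \<Rightarrow> nat. inj \<iota> \<and> range \<iota> \<subseteq> indices_in m V} = fact CARD('k)"
    unfolding eq using indices_in(1)[OF m V]
    by (subst card_inj_on_subset_funcset) (auto simp: c fact_prod_rev)
  show "finite {\<iota> :: 'k \<Rightarrow> nat. inj \<iota> \<and> range \<iota> \<subseteq> indices_in m V}"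
    by (rule card_ge_0_finite) (simp only: k fact_gt_zero)
qed

lemma ordering_listing:
  assumes m: "m \<in> configs" and V: "V \<in> \<X>" "V \<in> sets borel" and k: "emeasure m V = of_nat CARD('k::finite)"
    and \<iota>: "inj (\<iota> :: 'k \<Rightarrow> nat)" "range \<iota> \<subseteq> indices_in m V"
  shows "restrict_config V m = dirac_sum UNIV (\<lambda>j. snd (listing m) (\<iota> j))"
proof (rule measure_eqI)
  show "sets (restrict_config V m) = sets (dirac_sum UNIV (\<lambda>j. snd (listing m) (\<iota> j)))"
    by (simp add: configsD[OF m])
  have "card (indices_in m V) = card (range \<iota>)"
    using indices_in(2)[OF m V] k \<iota>(1) by (simp add: card_image)
  then have r: "range \<iota> = indices_in m V"
    using \<iota>(2) indices_in(1)[OF m V] by (simp add: card_subset_eq)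
  fix A assume "A \<in> sets (restrict_config V m)"
  then have A[measurable]: "A \<in> sets borel" by (simp add: configsD[OF m])
  note [measurable] = V(2)
  have "emeasure (restrict_config V m) A = emeasure m (A \<inter> V)"
    by (simp add: emeasure_restrict_config configsD[OF m] V)
  also have "\<dots> = of_nat (card (indices_in m (A \<inter> V)))"
    using V by (intro indices_in[OF m]) (auto intro: ideal_subset)
  also have "indices_in m (A \<inter> V) = \<iota> ` {j. snd (listing m) (\<iota> j) \<in> A}"
  proof -
    have "indices_in m (A \<inter> V) = {i \<in> indices_in m V. snd (listing m) i \<in> A}"
      by (auto simp: indices_in_def)
    then show ?thesis unfolding r[symmetric] by auto
  qed
  also have "card \<dots> = card {j. snd (listing m) (\<iota> j) \<in> A}"
    using \<iota>(1) by (intro card_image) (auto simp: inj_on_def)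
  finally show "emeasure (restrict_config V m) A = emeasure (dirac_sum UNIV (\<lambda>j. snd (listing m) (\<iota> j))) A"
    by (simp add: emeasure_dirac_sum_finite)
qed

text \<open>Boxes form a generator, stable under intersection, of the Borel sets of the power, and the mass of a box is a
  count of injections.\<close>
lemma measurable_ordering_kernel:
  assumes V: "open V" "V \<in> \<X>"
  shows "(ordering_kernel V :: 'a measure \<Rightarrow> ('k::finite \<Rightarrow> 'a) measure)
    \<in> measurable (borel_on (counting_space \<X>)) (subprob_algebra borel)"
proof -
  have Vm[measurable]: "V \<in> sets borel" using V by auto
  let ?K = "ordering_kernel V :: 'a measure \<Rightarrow> ('k \<Rightarrow> 'a) measure"
  have e: "emeasure (?K m) A = (if emeasure m V = of_nat CARD('k)
      then of_nat (card {\<iota>. inj \<iota> \<and> range \<iota> \<subseteq> indices_in m V \<and> (\<lambda>j. snd (listing m) (\<iota> j)) \<in> A}) / fact CARD('k) else 0)"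
    if m: "m \<in> configs" and A[measurable]: "A \<in> sets borel" for m and A :: "('k \<Rightarrow> 'a) set"
  proof -
    have "emeasure (?K m) A = (\<integral>\<^sup>+x. indicator A x \<partial>?K m)" by simp
    also have "\<dots> = (if emeasure m V = of_nat CARD('k)
      then (\<Sum>\<iota> | inj \<iota> \<and> range \<iota> \<subseteq> indices_in m V. indicator A (\<lambda>j. snd (listing m) (\<iota> j))) / fact CARD('k) else 0)"
      by (rule ordering_kernel_sum[OF m V(2) Vm]) simp
    finally show ?thesis
      using card_orderings(2)[OF m V(2) Vm, where 'k='k]
      by (auto simp: indicator_def sum.If_cases Int_def conj_assoc)
  qed
  let ?G = "prod_algebra UNIV (\<lambda>_::'k. borel :: 'a measure)"
  have one: "emeasure (?K m) UNIV \<le> 1" if m: "m \<in> configs" for m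
  proof -
    have "(fact CARD('k) :: ennreal) = of_nat (fact CARD('k))" by simp
    also have "\<dots> / \<dots> = 1"
      by (rule ennreal_divide_self) (auto simp del: of_nat_fact simp: ennreal_of_nat_eq_real_of_nat)
    finally have "(fact CARD('k) :: ennreal) / fact CARD('k) = 1" by simp
    then show ?thesis
      using e[OF m, of UNIV] card_orderings(1)[OF m V(2) Vm, where 'k='k] by simp
  qed
  show ?thesis
  proof (rule measurable_subprob_algebra_generated)
    show "sets borel = sigma_sets UNIV ?G"
      unfolding sets_PiM_equal_borel[symmetric] sets_PiM by simp
    show "Int_stable ?G" by (rule Int_stable_prod_algebra)
    show "?G \<subseteq> Pow UNIV" by auto
    show "subprob_space (?K m)" if "m \<in> space (borel_on (counting_space \<X>))" for m
      using one that by (intro subprob_spaceI) auto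
    show "sets (?K m) = sets borel" for m by simp
    have meas: "(\<lambda>m. emeasure (?K m) A) \<in> borel_measurable (borel_on (counting_space \<X>))"
      if "A \<in> ?G" for A
    proof -
      have A': "A \<in> sets borel"
        using that unfolding sets_PiM_equal_borel[symmetric] sets_PiM by auto
      obtain B where B: "A = PiE UNIV B" "\<And>j. B j \<in> sets borel"
        using \<open>A \<in> ?G\<close> by (auto simp: prod_algebra_eq_finite)
      have "{\<iota>. inj \<iota> \<and> range \<iota> \<subseteq> indices_in m V \<and> (\<lambda>j. snd (listing m) (\<iota> j)) \<in> A}
          = {\<iota> \<in> PiE UNIV (\<lambda>j. indices_in m (B j \<inter> V)). inj_on \<iota> UNIV}" for m
        unfolding B(1) by (auto simp: indices_in_def PiE_iff)
      then have e': "emeasure (?K m) A = (if emeasure m V = of_nat CARD('k) then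
           ennreal (real (card {\<iota> \<in> PiE UNIV (\<lambda>j. indices_in m (B j \<inter> V)). inj_on (\<iota> :: 'k \<Rightarrow> nat) UNIV})) / fact CARD('k) else 0)"
        if "m \<in> space (borel_on (counting_space \<X>))" for m
        using e[OF _ A', of m] that by (simp flip: ennreal_of_nat_eq_real_of_nat)
      have [measurable]: "(\<lambda>m. real (card {\<iota> \<in> PiE UNIV (\<lambda>j. indices_in m (B j \<inter> V)). inj_on (\<iota> :: 'k \<Rightarrow> nat) UNIV}))
         \<in> borel_measurable (borel_on (counting_space \<X>))"
        using B(2) by (intro measurable_card_injections[OF V]) auto
      have [measurable]: "(\<lambda>m. emeasure m V) \<in> borel_measurable (borel_on (counting_space \<X>))"
        using measurable_emeasure_config[OF V, of UNIV] by simp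
      have "(\<lambda>m. if emeasure m V = of_nat CARD('k) then
           ennreal (real (card {\<iota> \<in> PiE UNIV (\<lambda>j. indices_in m (B j \<inter> V)). inj_on (\<iota> :: 'k \<Rightarrow> nat) UNIV})) / fact CARD('k) else 0)
           \<in> borel_measurable (borel_on (counting_space \<X>))"
        by measurable
      then show ?thesis
        by (simp only: measurable_cong[OF e'])
    qed
    show "\<And>A. A \<in> ?G \<Longrightarrow> (\<lambda>m. emeasure (?K m) A) \<in> borel_measurable (borel_on (counting_space \<X>))"
      by (rule meas)
    have "(UNIV :: ('k \<Rightarrow> 'a) set) \<in> ?G"
      by (auto simp: prod_algebra_eq_finite intro!: exI[of _ "\<lambda>_. UNIV"])
    then show "(\<lambda>m. emeasure (?K m) UNIV) \<in> borel_measurable (borel_on (counting_space \<X>))"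
      by (rule meas)
  qed
qed

end

section \<open>Janossy measures as mixtures\<close>

lemma fact_ennreal: "(fact n :: ennreal) = ennreal (fact n)"
  using ennreal_of_nat_eq_real_of_nat[of "fact n"] by simp

lemma continuous_on_sum_coordinates:
  fixes \<phi> :: "'a::topological_space \<Rightarrow> real"
  assumes "continuous_on UNIV \<phi>"
  shows "continuous_on UNIV (\<lambda>x :: 'k::finite \<Rightarrow> 'a. \<Sum>i\<in>UNIV. \<phi> (x i))"
proof (rule continuous_on_sum)
  fix i :: 'k
  show "continuous_on UNIV (\<lambda>x :: 'k \<Rightarrow> 'a. \<phi> (x i))"
    by (rule continuous_on_compose2[OF assms continuous_on_product_coordinates]) simp
qed

context based_ideal begin

lemma janossy_measure_eq_bind:
  assumes P: "prob_space P" and \<eta>: "\<eta> \<in> measurable P (borel_on (counting_space \<X>))"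
    and V: "open V" "V \<in> \<X>"
  shows "(janossy_measure P \<eta> V :: ('k::finite \<Rightarrow> 'a) measure) = bind P (\<lambda>\<omega>. ordering_kernel V (\<eta> \<omega>))"
proof -
  let ?K = "\<lambda>\<omega>. ordering_kernel V (\<eta> \<omega>) :: ('k \<Rightarrow> 'a) measure"
  have K: "?K \<in> measurable P (subprob_algebra borel)"
    by (rule measurable_compose[OF \<eta> measurable_ordering_kernel[OF V]])
  have ne: "space P \<noteq> {}" by (rule prob_space.not_empty[OF P])
  have sets: "sets (bind P ?K) = sets borel" by (rule sets_bind[OF _ ne]) simp
  have space: "space (bind P ?K) = UNIV" using sets_eq_imp_space_eq[OF sets] by simp
  have [measurable]: "V \<in> sets borel" using V by auto
  have "bind P ?K = measure_of UNIV (sets borel) (emeasure (bind P ?K))"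
    using measure_of_of_measure[of "bind P ?K"] by (simp add: sets space)
  also have "\<dots> = janossy_measure P \<eta> V"
    unfolding janossy_measure_def
  proof (rule measure_of_eq)
    fix A :: "('k \<Rightarrow> 'a) set" assume "A \<in> sigma_sets UNIV (sets borel)"
    then have A[measurable]: "A \<in> sets borel" by (metis sets.sigma_sets_eq space_borel)
    let ?f = "\<lambda>\<omega>. indicator {\<omega>. emeasure (\<eta> \<omega>) V = of_nat CARD('k)} \<omega> *
                 emeasure (factorial_measure (\<eta> \<omega>)) (A \<inter> set_power V)"
    have e: "emeasure (?K \<omega>) A = ?f \<omega> / fact CARD('k)" for \<omega>
    proof -
      have "emeasure (?K \<omega>) A = (\<integral>\<^sup>+x. indicator {\<omega>. emeasure (\<eta> \<omega>) V = of_nat CARD('k)} \<omega> / fact CARD('k) *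
           indicator (A \<inter> set_power V) x \<partial>factorial_measure (\<eta> \<omega>))"
        unfolding ordering_kernel_def factorial_measure_listing
        by (subst emeasure_density) (auto intro!: nn_integral_cong simp: indicator_def)
      also have "\<dots> = indicator {\<omega>. emeasure (\<eta> \<omega>) V = of_nat CARD('k)} \<omega> / fact CARD('k)
           * emeasure (factorial_measure (\<eta> \<omega>)) (A \<inter> set_power V)"
        by (rule nn_integral_cmult_indicator) (simp add: factorial_measure_listing)
      finally show ?thesis by (simp add: divide_ennreal_def ac_simps)
    qed
    have fk: "(fact CARD('k) :: ennreal) \<noteq> 0" "(fact CARD('k) :: ennreal) \<noteq> top"
      by (simp_all add: fact_ennreal)
    have f: "?f \<omega> = fact CARD('k) * emeasure (?K \<omega>) A" for \<omega>
      unfolding e ennreal_times_divide mult.commute[of "fact CARD('k)"] mult_divide_eq_ennreal[OF fk] ..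
    have "(\<lambda>\<omega>. emeasure (?K \<omega>) A) \<in> borel_measurable P"
      by (rule measurable_emeasure_subprob_algebra[OF A, THEN measurable_compose[OF K]])
    then have m: "?f \<in> borel_measurable P" unfolding f by simp
    have "emeasure (bind P ?K) A = (\<integral>\<^sup>+\<omega>. emeasure (?K \<omega>) A \<partial>P)"
      by (rule emeasure_bind[OF ne K A])
    also have "\<dots> = (\<integral>\<^sup>+\<omega>. ?f \<omega> \<partial>P) / fact CARD('k)"
      unfolding e by (rule nn_integral_divide[OF m])
    finally show "emeasure (bind P ?K) A = (\<integral>\<^sup>+\<omega>. ?f \<omega> \<partial>P) / fact CARD('k)" .
  qed auto
  finally show ?thesis ..
qed

lemma measurable_integral_ordering_kernel:
  fixes h :: "('k::finite \<Rightarrow> 'a) \<Rightarrow> real"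
  assumes \<eta>: "\<eta> \<in> measurable P (borel_on (counting_space \<X>))" and V: "open V" "V \<in> \<X>"
    and h: "h \<in> borel_measurable borel"
  shows "(\<lambda>\<omega>. \<integral>x. h x \<partial>ordering_kernel V (\<eta> \<omega>)) \<in> borel_measurable P"
  by (rule measurable_compose[OF measurable_compose[OF \<eta> measurable_ordering_kernel[OF V]]
        integral_measurable_subprob_algebra[OF h]])

lemma integral_janossy_measure:
  fixes h :: "('k::finite \<Rightarrow> 'a) \<Rightarrow> real"
  assumes P: "prob_space P" and \<eta>: "\<eta> \<in> measurable P (borel_on (counting_space \<X>))"
    and V: "open V" "V \<in> \<X>" and h: "h \<in> borel_measurable borel" "\<And>x. \<bar>h x\<bar> \<le> C"
  shows "(\<integral>x. h x \<partial>janossy_measure P \<eta> V) = (\<integral>\<omega>. (\<integral>x. h x \<partial>ordering_kernel V (\<eta> \<omega>)) \<partial>P)"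
proof -
  have K: "(\<lambda>\<omega>. ordering_kernel V (\<eta> \<omega>)) \<in> measurable P (subprob_algebra borel)"
    by (rule measurable_compose[OF \<eta> measurable_ordering_kernel[OF V]])
  show ?thesis
    unfolding janossy_measure_eq_bind[OF P \<eta> V]
  proof (rule integral_bind[OF h(1) _ K])
    show "finite_measure P" using P by (simp add: prob_space_def)
    show "AE \<omega> in P. emeasure (ordering_kernel V (\<eta> \<omega>) :: ('k \<Rightarrow> 'a) measure) (space (ordering_kernel V (\<eta> \<omega>) :: ('k \<Rightarrow> 'a) measure)) \<le> ennreal 1"
      using subprob_space.emeasure_space_le_1[OF subprob_space_kernel[OF K]] by (intro AE_I2) auto
  qed (use h in auto)
qed

lemma integral_ordering_kernel:
  fixes h :: "('k::finite \<Rightarrow> 'a) \<Rightarrow> real"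
  assumes m: "m \<in> configs" and V: "V \<in> \<X>" "V \<in> sets borel"
    and h: "h \<in> borel_measurable borel" "\<And>x. 0 \<le> h x"
  shows "(\<integral>x. h x \<partial>ordering_kernel V m) = (if emeasure m V = of_nat CARD('k)
    then (\<Sum>\<iota> | inj \<iota> \<and> range \<iota> \<subseteq> indices_in m V. h (\<lambda>j. snd (listing m) (\<iota> j))) / fact CARD('k) else 0)"
proof -
  have [measurable_cong]: "sets (ordering_kernel V m :: ('k \<Rightarrow> 'a) measure) = sets borel" by simp
  have "(\<integral>x. h x \<partial>ordering_kernel V m) = enn2real (\<integral>\<^sup>+x. ennreal (h x) \<partial>ordering_kernel V m)"
    using h by (intro integral_eq_nn_integral) auto
  also have "(\<integral>\<^sup>+x. ennreal (h x) \<partial>ordering_kernel V m) = (if emeasure m V = of_nat CARD('k)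
    then (\<Sum>\<iota> | inj \<iota> \<and> range \<iota> \<subseteq> indices_in m V. ennreal (h (\<lambda>j. snd (listing m) (\<iota> j)))) / fact CARD('k) else 0)"
    using h by (intro ordering_kernel_sum[OF m V]) auto
  also have "\<dots> = ennreal (if emeasure m V = of_nat CARD('k)
    then (\<Sum>\<iota> | inj \<iota> \<and> range \<iota> \<subseteq> indices_in m V. h (\<lambda>j. snd (listing m) (\<iota> j))) / fact CARD('k) else 0)"
    using h(2) by (simp add: fact_ennreal sum_ennreal divide_ennreal sum_nonneg)
  finally show ?thesis
    using h(2) by (simp add: sum_nonneg)
qed

text \<open>The kernel is an average over \<open>k!\<close> orderings, each of which lists the points of \<open>m\<close> in \<open>V\<close>; hence a bound that
  holds for all listings passes to the integral.\<close>
lemma integral_ordering_kernel_le: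
  fixes h :: "('k::finite \<Rightarrow> 'a) \<Rightarrow> real"
  assumes m: "m \<in> configs" and V: "V \<in> \<X>" "V \<in> sets borel"
    and h: "h \<in> borel_measurable borel" "\<And>x. 0 \<le> h x"
    and le: "0 \<le> c" "\<And>y. restrict_config V m = dirac_sum UNIV y \<Longrightarrow> h y \<le> c"
  shows "(\<integral>x. h x \<partial>ordering_kernel V m) \<le> c"
proof (cases "emeasure m V = of_nat CARD('k)")
  case True
  note card = card_orderings[OF m V True]
  have "(\<Sum>\<iota> | inj \<iota> \<and> range \<iota> \<subseteq> indices_in m V. h (\<lambda>j. snd (listing m) (\<iota> j)))
    \<le> of_nat (card {\<iota> :: 'k \<Rightarrow> nat. inj \<iota> \<and> range \<iota> \<subseteq> indices_in m V}) * c"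
    using le(2) ordering_listing[OF m V True] by (intro sum_bounded_above) auto
  then show ?thesis
    unfolding integral_ordering_kernel[OF m V h] card using True by (simp add: field_simps)
qed (use le(1) integral_ordering_kernel[OF m V h] in simp)

lemma integral_ordering_kernel_eq:
  fixes h :: "('k::finite \<Rightarrow> 'a) \<Rightarrow> real"
  assumes m: "m \<in> configs" and V: "V \<in> \<X>" "V \<in> sets borel"
    and h: "h \<in> borel_measurable borel" "\<And>x. 0 \<le> h x"
    and k: "emeasure m V = of_nat CARD('k)"
    and eq: "\<And>y. restrict_config V m = dirac_sum UNIV y \<Longrightarrow> h y = c"
  shows "(\<integral>x. h x \<partial>ordering_kernel V m) = c"
proof -
  note card = card_orderings[OF m V k]
  have "(\<Sum>\<iota> | inj \<iota> \<and> range \<iota> \<subseteq> indices_in m V. h (\<lambda>j. snd (listing m) (\<iota> j)))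
    = (\<Sum>\<iota> :: 'k \<Rightarrow> nat | inj \<iota> \<and> range \<iota> \<subseteq> indices_in m V. c)"
    using eq ordering_listing[OF m V k] by (intro sum.cong) auto
  then show ?thesis
    unfolding integral_ordering_kernel[OF m V h] using k card(1) by simp
qed

section \<open>Continuity of the map from points to configurations\<close>

lemma continuous_map_counting_spaceI:
  assumes "\<And>x. x \<in> topspace A \<Longrightarrow> f x \<in> configs"
    and cont: "\<And>\<phi>. \<phi> \<in> ideal_test_functions euclidean \<X> \<Longrightarrow> continuous_map A euclideanreal (\<lambda>x. \<integral>y. \<phi> y \<partial>f x)"
  shows "continuous_map A (counting_space \<X>) f"
  unfolding counting_space_def continuous_map_in_subtopology
proof
  show "f \<in> topspace A \<rightarrow> configs" using assms(1) by auto
  have im: "f ` topspace A \<subseteq> configs" using assms(1) by auto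
  have "configs \<subseteq> ideal_measures euclidean \<X>" by (auto simp: counting_measures_def)
  show "continuous_map A (vague_topology euclidean \<X>) f"
    unfolding vague_topology_def continuous_on_generated_topo_iff
  proof (intro conjI allI impI)
    fix S assume "S \<in> {{\<mu> \<in> ideal_measures euclidean \<X>. (\<integral>x. \<phi> x \<partial>\<mu>) \<in> V} | \<phi> V.
        \<phi> \<in> ideal_test_functions euclidean \<X> \<and> open V}"
    then obtain \<phi> V where S: "S = {\<mu> \<in> ideal_measures euclidean \<X>. (\<integral>x. \<phi> x \<partial>\<mu>) \<in> V}"
      "\<phi> \<in> ideal_test_functions euclidean \<X>" "open V" by blast
    have "f -` S \<inter> topspace A = {x \<in> topspace A. (\<integral>y. \<phi> y \<partial>f x) \<in> V}"
      unfolding S(1) using im \<open>configs \<subseteq> _\<close> by auto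
    then show "openin A (f -` S \<inter> topspace A)"
      using openin_continuous_map_preimage[OF cont[OF S(2)], of V] S(3) by simp
  next
    have "(\<lambda>x. 0) \<in> ideal_test_functions euclidean \<X>" by (auto simp: test_functions_iff)
    then have "{\<mu> \<in> ideal_measures euclidean \<X>. (\<integral>x. (\<lambda>x. 0) x \<partial>\<mu>) \<in> (UNIV :: real set)} \<in>
       {{\<mu> \<in> ideal_measures euclidean \<X>. (\<integral>x. \<phi> x \<partial>\<mu>) \<in> V} | \<phi> V.
        \<phi> \<in> ideal_test_functions euclidean \<X> \<and> open V}" by blast
    then have "ideal_measures euclidean \<X> \<subseteq> \<Union> {{\<mu> \<in> ideal_measures euclidean \<X>. (\<integral>x. \<phi> x \<partial>\<mu>) \<in> V} | \<phi> V.
        \<phi> \<in> ideal_test_functions euclidean \<X> \<and> open V}" by (intro subset_trans[OF _ Union_upper]) auto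
    then show "f ` topspace A \<subseteq> \<Union> {{\<mu> \<in> ideal_measures euclidean \<X>. (\<integral>x. \<phi> x \<partial>\<mu>) \<in> V} | \<phi> V.
        \<phi> \<in> ideal_test_functions euclidean \<X> \<and> open V}"
      using im \<open>configs \<subseteq> _\<close> by (meson subset_trans)
  qed
qed

lemma continuous_map_integral:
  assumes "\<phi> \<in> ideal_test_functions euclidean \<X>"
  shows "continuous_map (counting_space \<X>) euclideanreal (\<lambda>m. \<integral>x. \<phi> x \<partial>m)"
  using openin_integral[OF assms] by (auto simp: continuous_map_def)

lemma continuous_map_dirac_sum:
  "continuous_map (top_of_set (set_power carrier_set)) (counting_space \<X>)
     (dirac_sum UNIV :: ('k::finite \<Rightarrow> 'a) \<Rightarrow> 'a measure)"
proof (rule continuous_map_counting_spaceI)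
  fix \<phi> assume \<phi>: "\<phi> \<in> ideal_test_functions euclidean \<X>"
  have "continuous_on UNIV (\<lambda>x :: 'k \<Rightarrow> 'a. \<Sum>i\<in>UNIV. \<phi> (x i))"
    using \<phi> by (intro continuous_on_sum_coordinates) (auto simp: test_functions_iff)
  then show "continuous_map (top_of_set (set_power carrier_set)) euclideanreal
      (\<lambda>x :: 'k \<Rightarrow> 'a. \<integral>y. \<phi> y \<partial>dirac_sum UNIV x)"
    using test_function_borel_measurable[OF \<phi>]
    by (auto simp: integral_dirac_sum intro: continuous_on_subset)
qed (auto simp: dirac_sum_in_configs_iff)

text \<open>A configuration that agrees on a large window with \<open>\<delta> y\<close>, for \<open>y\<close> close to \<open>x\<^sub>0\<close>, is vaguely close to
  \<open>\<delta> x\<^sub>0\<close>, whatever it does outside the window.  For a subbasic set this holds because the support of the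
  test function lies in the window; the property is stable under finite intersections and arbitrary unions.\<close>
lemma eventually_restrict_config_imp_in_open:
  fixes x0 :: "'k::finite \<Rightarrow> 'a"
  assumes Q: "openin (counting_space \<X>) Q" and x0: "dirac_sum UNIV x0 \<in> Q"
  shows "\<forall>\<^sub>F (n, y) in sequentially \<times>\<^sub>F nhds x0.
    \<forall>m\<in>configs. restrict_config (window n) m = dirac_sum UNIV y \<longrightarrow> m \<in> Q"
proof -
  obtain Q' where Q': "openin (vague_topology euclidean \<X>) Q'" "Q = Q' \<inter> configs"
    using Q by (auto simp: counting_space_def openin_subtopology)
  have "generate_topology_on {{\<mu> \<in> ideal_measures euclidean \<X>. (\<integral>x. \<phi> x \<partial>\<mu>) \<in> V} | \<phi> V.
        \<phi> \<in> ideal_test_functions euclidean \<X> \<and> open V} Q'"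
    using Q'(1) unfolding vague_topology_def by (rule openin_topology_generated_by)
  moreover have "dirac_sum UNIV x0 \<in> Q'" using x0 Q' by auto
  ultimately have "\<forall>\<^sub>F (n, y) in sequentially \<times>\<^sub>F nhds x0.
    \<forall>m\<in>configs. restrict_config (window n) m = dirac_sum UNIV y \<longrightarrow> m \<in> Q'"
  proof (induction rule: generate_topology_on.induct)
    case Empty
    then show ?case by simp
  next
    case (Int a b)
    then have "\<forall>\<^sub>F (n, y) in sequentially \<times>\<^sub>F nhds x0.
        \<forall>m\<in>configs. restrict_config (window n) m = dirac_sum UNIV y \<longrightarrow> m \<in> a"
      "\<forall>\<^sub>F (n, y) in sequentially \<times>\<^sub>F nhds x0.
        \<forall>m\<in>configs. restrict_config (window n) m = dirac_sum UNIV y \<longrightarrow> m \<in> b" by auto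
    then show ?case by eventually_elim auto
  next
    case (UN K)
    then obtain k where k: "k \<in> K" "dirac_sum UNIV x0 \<in> k" by auto
    from UN.IH[OF this] show ?case
      by (rule eventually_mono) (use k in auto)
  next
    case (Basis s)
    then obtain \<phi> V where s: "s = {\<mu> \<in> ideal_measures euclidean \<X>. (\<integral>x. \<phi> x \<partial>\<mu>) \<in> V}"
      and \<phi>: "\<phi> \<in> ideal_test_functions euclidean \<X>" and V: "open V" by blast
    note \<phi>m[measurable] = test_function_borel_measurable[OF \<phi>]
    obtain N where N: "closure {x. \<phi> x \<noteq> 0} \<subseteq> window N"
      using \<phi> ideal_window by (auto simp: test_functions_iff)
    have "continuous_on UNIV (\<lambda>x :: 'k \<Rightarrow> 'a. \<Sum>i\<in>UNIV. \<phi> (x i))"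
      using \<phi> by (intro continuous_on_sum_coordinates) (auto simp: test_functions_iff)
    then have "((\<lambda>x. \<Sum>i\<in>UNIV. \<phi> (x i)) \<longlongrightarrow> (\<Sum>i\<in>UNIV. \<phi> (x0 i))) (nhds x0)"
      by (simp add: continuous_on_eq_continuous_at tendsto_nhds_iff isCont_def)
    moreover have "(\<Sum>i\<in>UNIV. \<phi> (x0 i)) \<in> V"
      using Basis by (simp add: s integral_dirac_sum)
    ultimately have "\<forall>\<^sub>F y in nhds x0. (\<Sum>i\<in>UNIV. \<phi> (y i)) \<in> V"
      using V by (auto simp: tendsto_def)
    with eventually_ge_at_top[of N]
    have "\<forall>\<^sub>F (n, y) in sequentially \<times>\<^sub>F nhds x0. N \<le> n \<and> (\<Sum>i\<in>UNIV. \<phi> (y i)) \<in> V"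
      unfolding case_prod_beta by (rule eventually_prodI)
    then show ?case
    proof (rule eventually_mono, clarify)
      fix n y m assume n: "N \<le> n" and y: "(\<Sum>i\<in>UNIV. \<phi> (y i)) \<in> V" and m: "m \<in> configs"
        and eq: "restrict_config (window n) m = dirac_sum UNIV (y :: 'k \<Rightarrow> 'a)"
      have [measurable_cong]: "sets m = sets borel" by (rule configsD[OF m])
      have "(\<integral>x. \<phi> x \<partial>m) = (\<integral>x. \<phi> x \<partial>restrict_config (window n) m)"
        using N window_mono[OF n] closure_subset[of "{x. \<phi> x \<noteq> 0}"]
        by (intro integral_restrict_config[symmetric]) auto
      also have "\<dots> = (\<Sum>i\<in>UNIV. \<phi> (y i))" unfolding eq by (simp add: integral_dirac_sum)
      finally show "m \<in> s" using y m by (auto simp: s counting_measures_def)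
    qed
  qed
  then show ?thesis
    by (rule eventually_mono) (auto simp: Q'(2))
qed

end

section \<open>Approximation from below by functions of finitely many points\<close>

lemma borel_measurable_zero_extension:
  fixes F :: "'e \<Rightarrow> real"
  assumes Y: "openin E Y" and F: "continuous_map (subtopology E Y) euclideanreal F"
    and z: "\<And>m. m \<notin> Y \<Longrightarrow> F m = 0"
  shows "F \<in> borel_measurable (borel_on E)"
proof (rule borel_measurableI)
  fix S :: "real set" assume S: "open S"
  have YE: "Y \<subseteq> topspace E" using Y by (rule openin_subset)
  have "openin (subtopology E Y) {m \<in> topspace (subtopology E Y). F m \<in> S}"
    using F S by (intro openin_continuous_map_preimage) auto
  then have "openin E {m \<in> topspace (subtopology E Y). F m \<in> S}"
    using Y by (rule openin_trans_full)
  then have 1: "{m \<in> topspace (subtopology E Y). F m \<in> S} \<in> sets (borel_on E)"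
    by (rule openin_in_sets_borel_on)
  have Ys: "Y \<in> sets (borel_on E)" using Y by (rule openin_in_sets_borel_on)
  have 2: "topspace E - Y \<in> sets (borel_on E)" using sets.compl_sets[OF Ys] by simp
  have "F -` S \<inter> space (borel_on E) = {m \<in> topspace (subtopology E Y). F m \<in> S} \<union> (if 0 \<in> S then topspace E - Y else {})"
    using YE z by (auto, metis)
  then show "F -` S \<inter> space (borel_on E) \<in> sets (borel_on E)" using 1 2 by simp
qed

text \<open>The largest \<open>L\<close>-Lipschitz function below \<open>G\<close>.  It makes a function continuous that is only known to be
  locally bounded from below.\<close>
definition lipschitz_minorant :: "real \<Rightarrow> ('b::metric_space \<Rightarrow> real) \<Rightarrow> 'b \<Rightarrow> real" where
  "lipschitz_minorant L G x = (INF y. G y + L * dist x y)"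

context
  fixes G :: "'b::metric_space \<Rightarrow> real" and L :: real
  assumes G: "\<And>y. 0 \<le> G y" and L: "0 \<le> L"
begin

lemma lipschitz_minorant_bdd: "bdd_below (range (\<lambda>y. G y + L * dist x y))"
  using G L by (intro bdd_belowI[of _ 0]) auto

lemma lipschitz_minorant_le: "lipschitz_minorant L G x \<le> G x"
  unfolding lipschitz_minorant_def using cINF_lower[OF lipschitz_minorant_bdd, of x x] by simp

lemma lipschitz_minorant_nonneg: "0 \<le> lipschitz_minorant L G x"
  unfolding lipschitz_minorant_def using G L by (intro cINF_greatest) auto

text \<open>Points within distance \<open>r\<close> contribute at least \<open>c\<close>, the others at least \<open>L r\<close> by the distance penalty.\<close>
lemma lipschitz_minorant_ge:
  assumes "\<And>y. dist x y < r \<Longrightarrow> c \<le> G y"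
  shows "min c (L * r) \<le> lipschitz_minorant L G x"
  unfolding lipschitz_minorant_def
proof (rule cINF_greatest)
  fix y
  show "min c (L * r) \<le> G y + L * dist x y"
  proof (cases "dist x y < r")
    case True
    then show ?thesis using assms[OF True] mult_nonneg_nonneg[OF L zero_le_dist[of x y]] by simp
  next
    case False
    then have "L * r \<le> L * dist x y" using L by (intro mult_left_mono) auto
    then show ?thesis using G[of y] by auto
  qed
qed simp

lemma continuous_on_lipschitz_minorant: "continuous_on UNIV (lipschitz_minorant L G)"
proof (rule lipschitz_on_continuous_on[of L])
  have le: "lipschitz_minorant L G x - L * dist x z \<le> lipschitz_minorant L G z" for x z
    unfolding lipschitz_minorant_def[of L G z]
  proof (rule cINF_greatest)
    fix y
    have "lipschitz_minorant L G x \<le> G y + L * dist x y"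
      unfolding lipschitz_minorant_def by (rule cINF_lower[OF lipschitz_minorant_bdd]) simp
    also have "\<dots> \<le> G y + L * (dist x z + dist z y)"
      using L by (intro add_left_mono mult_left_mono dist_triangle)
    finally show "lipschitz_minorant L G x - L * dist x z \<le> G y + L * dist z y"
      by (simp add: algebra_simps)
  qed simp
  show "L-lipschitz_on UNIV (lipschitz_minorant L G)"
  proof (rule lipschitz_onI[OF _ L])
    fix x z show "dist (lipschitz_minorant L G x) (lipschitz_minorant L G z) \<le> L * dist x z"
      using le[of x z] le[of z x] by (simp add: dist_real_def dist_commute[of z x] abs_le_iff)
  qed
qed

end

context based_ideal begin

lemma Union_counting_ideal:
  "\<Union>(counting_ideal k \<X>) = (\<Union>i. {m \<in> configs. of_nat k \<le> emeasure m (U i)})"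
proof (intro equalityI subsetI)
  fix m assume "m \<in> \<Union>(counting_ideal k \<X>)"
  then obtain A where A: "m \<in> configs" "A \<in> \<X>" "A \<in> sets borel" "of_nat k \<le> emeasure m A"
    by (auto simp: counting_ideal_def)
  obtain i where "A \<subseteq> U i" using ideal_base[OF A(2)] by auto
  then have "emeasure m A \<le> emeasure m (U i)"
    using configsD(1)[OF A(1)] by (intro emeasure_mono) auto
  then show "m \<in> (\<Union>i. {m \<in> configs. of_nat k \<le> emeasure m (U i)})" using A by (auto intro: order_trans)
next
  fix m assume "m \<in> (\<Union>i. {m \<in> configs. of_nat k \<le> emeasure m (U i)})"
  then obtain i where "m \<in> configs" "of_nat k \<le> emeasure m (U i)" by auto
  then have "{m} \<in> counting_ideal k \<X>"
    by (auto simp: counting_ideal_def intro!: bexI[of _ "U i"])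
  then show "m \<in> \<Union>(counting_ideal k \<X>)" by blast
qed

text \<open>Openness matters because test functions are continuous on this set and are extended by zero outside it.\<close>
lemma openin_Union_counting_ideal: "openin (counting_space \<X>) (\<Union>(counting_ideal k \<X>))"
  unfolding Union_counting_ideal
  by (intro openin_Union) (use openin_emeasure_ge[OF open_U U_in_ideal] in blast)

lemma dirac_sum_in_Union_counting_ideal:
  fixes x :: "'k::finite \<Rightarrow> 'a"
  assumes "x \<in> set_power carrier_set"
  shows "dirac_sum UNIV x \<in> \<Union>(counting_ideal CARD('k) \<X>)"
proof -
  have "range x \<subseteq> carrier_set" using assms by (auto simp: set_power_def)
  then obtain i where i: "range x \<subseteq> U i" using finite_subset_base[of "range x"] by auto
  have "emeasure (dirac_sum UNIV x) (U i) = of_nat CARD('k)"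
    using i by (subst emeasure_dirac_sum_finite) (auto simp: image_subset_iff)
  then show ?thesis
    using assms unfolding Union_counting_ideal by (auto simp: dirac_sum_in_configs_iff intro!: exI[of _ i])
qed

lemma borel_measurable_dirac_sum_comp:
  fixes F :: "'a measure \<Rightarrow> real"
  assumes F: "continuous_map (subtopology (counting_space \<X>) (\<Union>(counting_ideal CARD('k) \<X>))) euclideanreal F"
    and z: "\<And>m. m \<notin> \<Union>(counting_ideal CARD('k) \<X>) \<Longrightarrow> F m = 0"
  shows "(\<lambda>x :: 'k::finite \<Rightarrow> 'a. F (dirac_sum UNIV x)) \<in> borel_measurable borel"
proof -
  have "(\<lambda>x :: 'k \<Rightarrow> 'a. F (dirac_sum UNIV x)) \<in> borel_measurable (borel_on euclidean)"
  proof (rule borel_measurable_zero_extension)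
    show "openin euclidean (set_power carrier_set :: ('k \<Rightarrow> 'a) set)"
      using open_set_power[OF open_carrier_set] by simp
    have "continuous_map (top_of_set (set_power carrier_set))
        (subtopology (counting_space \<X>) (\<Union>(counting_ideal CARD('k) \<X>))) (dirac_sum UNIV :: ('k \<Rightarrow> 'a) \<Rightarrow> 'a measure)"
      using continuous_map_dirac_sum dirac_sum_in_Union_counting_ideal
      by (auto simp: continuous_map_in_subtopology simp del: Union_iff)
    from continuous_map_compose[OF this F]
    show "continuous_map (top_of_set (set_power carrier_set)) euclideanreal (\<lambda>x :: 'k \<Rightarrow> 'a. F (dirac_sum UNIV x))"
      by (simp add: o_def)
    fix x :: "'k \<Rightarrow> 'a" assume "x \<notin> set_power carrier_set"
    then have "dirac_sum UNIV x \<notin> configs" by (simp add: dirac_sum_in_configs_iff)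
    then show "F (dirac_sum UNIV x) = 0"
      by (intro z) (auto simp: counting_ideal_def)
  qed
  then show ?thesis by simp
qed

lemma restrict_config_dirac_sum:
  fixes y :: "'k::finite \<Rightarrow> 'a"
  assumes "B \<in> sets borel" "y \<in> set_power B"
  shows "restrict_config B (dirac_sum UNIV y) = dirac_sum UNIV y"
proof (rule restrict_config_listingD(2)[of UNIV])
  show "restrict_config UNIV (dirac_sum UNIV y) = dirac_sum UNIV y"
    by (rule measure_eqI) (auto simp: emeasure_restrict_config)
qed (use assms in auto)

text \<open>The value \<open>h n x\<close> must lie below \<open>F m\<close> for every \<open>m\<close> with \<open>\<delta> x\<close> in the window, as nothing is known
  about \<open>m\<close> outside, so one starts from the infimum over all these \<open>m\<close>.  By continuity of \<open>F\<close> at \<open>\<delta> x\<close> this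
  infimum is nearly \<open>F (\<delta> x)\<close> for large windows, uniformly in a neighbourhood of \<open>x\<close>; therefore the
  Lipschitz minorant loses nothing in the limit.\<close>
lemma lower_approximation:
  fixes F :: "'a measure \<Rightarrow> real"
  assumes F: "continuous_map (subtopology (counting_space \<X>) (\<Union>(counting_ideal CARD('k::finite) \<X>))) euclideanreal F"
    and F0: "\<And>m. 0 \<le> F m" and FM: "\<And>m. F m \<le> M"
  obtains h :: "nat \<Rightarrow> ('k::finite \<Rightarrow> 'a) \<Rightarrow> real" where
    "\<And>n. continuous_on UNIV (h n)" "\<And>n x. 0 \<le> h n x" "\<And>n x. h n x \<le> M"
    "\<And>n x. x \<notin> set_power (window n) \<Longrightarrow> h n x = 0"
    "\<And>n m x. m \<in> configs \<Longrightarrow> restrict_config (window n) m = dirac_sum UNIV x \<Longrightarrow> h n x \<le> F m"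
    "\<And>x c. x \<in> set_power carrier_set \<Longrightarrow> c < F (dirac_sum UNIV x) \<Longrightarrow> \<forall>\<^sub>F n in sequentially. c < h n x"
proof -
  let ?Y = "\<Union>(counting_ideal CARD('k) \<X>)"
  define R where "R n y = {m \<in> configs. restrict_config (window n) m = dirac_sum UNIV (y :: 'k \<Rightarrow> 'a)}" for n y
  \<comment> \<open>outside the power of the window the value 0 forces the support of \<open>h n\<close> into it\<close>
  define G where "G n y = (if y \<in> set_power (window n) then INF m\<in>R n y. F m else 0)" for n y
  define h where "h n = lipschitz_minorant (real n) (G n)" for n
  have bdd: "bdd_below (F ` S)" for S using F0 by (intro bdd_belowI[of _ 0]) auto
  have M0: "0 \<le> M" using F0 FM by (rule order_trans)
  have inR: "dirac_sum UNIV y \<in> R n y" if "y \<in> set_power (window n)" for n y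
  proof -
    have "y \<in> set_power carrier_set" using that window_in_ideal[of n] by (auto simp: set_power_def)
    then show ?thesis using that by (simp add: R_def dirac_sum_in_configs_iff restrict_config_dirac_sum)
  qed
  have G0: "0 \<le> G n y" for n y
    unfolding G_def using inR F0 by (auto intro!: cINF_greatest)
  have GM: "G n y \<le> M" for n y
    unfolding G_def using cINF_lower2[OF bdd inR FM] M0 by auto
  have hG: "h n x \<le> G n x" for n x unfolding h_def by (rule lipschitz_minorant_le[OF G0]) simp
  have h0: "0 \<le> h n x" for n x unfolding h_def by (rule lipschitz_minorant_nonneg[OF G0]) simp
  show thesis
  proof (rule that[of h])
    show "continuous_on UNIV (h n)" for n
      unfolding h_def by (rule continuous_on_lipschitz_minorant[OF G0]) simp
    show "0 \<le> h n x" for n x by (rule h0)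
    show "h n x \<le> M" for n x using hG GM by (rule order_trans)
    show "h n x = 0" if "x \<notin> set_power (window n)" for n x
      using hG[of n x] h0[of n x] that by (simp add: G_def)
    show "h n x \<le> F m" if "m \<in> configs" "restrict_config (window n) m = dirac_sum UNIV x" for n m x
    proof -
      have "x \<in> set_power (window n)"
        by (rule restrict_config_listingD(1)[OF that(2)]) (use configsD(1)[OF that(1)] in auto)
      then have "G n x \<le> F m"
        unfolding G_def using that by (auto simp: R_def intro!: cINF_lower[OF bdd])
      then show ?thesis using hG by (rule order_trans[rotated])
    qed
    show "\<forall>\<^sub>F n in sequentially. c < h n x" if x: "x \<in> set_power carrier_set" and c: "c < F (dirac_sum UNIV x)" for x c
    proof -
      obtain d where d: "c < d" "d < F (dirac_sum UNIV x)" using dense[OF c] by auto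
      have xY: "dirac_sum UNIV x \<in> ?Y" by (rule dirac_sum_in_Union_counting_ideal[OF x])
      define Q where "Q = {m \<in> topspace (subtopology (counting_space \<X>) ?Y). F m \<in> {d<..}}"
      have "openin (subtopology (counting_space \<X>) ?Y) Q"
        unfolding Q_def using F by (rule openin_continuous_map_preimage) auto
      then have Q: "openin (counting_space \<X>) Q"
        by (rule openin_trans_full) (rule openin_Union_counting_ideal)
      have "dirac_sum UNIV x \<in> Q"
        using xY d x dirac_sum_in_configs_iff by (auto simp: Q_def)
      from eventually_restrict_config_imp_in_open[OF Q this]
      obtain Pf Pg where P: "eventually Pf sequentially" "eventually Pg (nhds x)"
        "\<And>n y. Pf n \<Longrightarrow> Pg y \<Longrightarrow> \<forall>m\<in>configs. restrict_config (window n) m = dirac_sum UNIV y \<longrightarrow> m \<in> Q"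
        unfolding eventually_prod_filter by auto
      obtain i where i: "range x \<subseteq> U i"
        using finite_subset_base[of "range x"] x by (auto simp: set_power_def)
      have win: "U i \<subseteq> window n" if "i \<le> n" for n using that by (auto simp: window_def)
      have "x \<in> set_power (U i)" using i by (auto simp: set_power_def)
      then have "eventually (\<lambda>y. y \<in> set_power (U i)) (nhds x)"
        using open_set_power[of "U i"] by (intro eventually_nhds_in_open) auto
      with P(2) have "eventually (\<lambda>y. Pg y \<and> y \<in> set_power (U i)) (nhds x)"
        by (rule eventually_conj)
      then obtain r where r: "0 < r" "\<And>y. dist y x < r \<Longrightarrow> Pg y \<and> y \<in> set_power (U i)"
        unfolding eventually_nhds_metric by auto
      \<comment> \<open>beyond distance \<open>r\<close> the penalty \<open>n * r\<close> eventually exceeds any bound\<close>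
      have "filterlim (\<lambda>n. real n * r) at_top sequentially"
        using r(1) by (intro filterlim_at_top_mult_tendsto_pos[where c=r] filterlim_real_sequentially tendsto_const)
          (auto simp: mult.commute intro: filterlim_real_sequentially)
      then have "\<forall>\<^sub>F n in sequentially. d \<le> real n * r" by (simp add: filterlim_at_top)
      with P(1) eventually_ge_at_top[of i] show ?thesis
      proof eventually_elim
        case (elim n)
        have "d \<le> G n y" if y: "dist x y < r" for y
        proof -
          have y': "Pg y" "y \<in> set_power (U i)" using r(2)[of y] y by (auto simp: dist_commute)
          then have yw: "y \<in> set_power (window n)" using win[OF elim(2)] by (auto simp: set_power_def)
          have "d \<le> F m" if "m \<in> R n y" for m
            using P(3)[OF elim(1) y'(1)] that by (auto simp: R_def Q_def)
          then show ?thesis using yw inR[OF yw] by (auto simp: G_def intro!: cINF_greatest)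
        qed
        from lipschitz_minorant_ge[OF G0 _ this, where L="real n"]
        have "min d (real n * r) \<le> h n x" unfolding h_def by simp
        then show ?case using elim(3) d(1) by simp
      qed
    qed
  qed
qed

end

section \<open>Scaling of configurations\<close>

locale scaled_ideal = based_ideal +
  fixes T :: "real \<Rightarrow> 'a \<Rightarrow> 'a"
  assumes scaling: "continuous_scaling euclidean T"
    and scaling_consistent: "scaling_consistent T \<X>"
begin

lemma T_inverse [simp]:
  assumes "0 < t" shows "T t (T (inverse t) x) = x" "T (inverse t) (T t x) = x"
  using scaling assms unfolding continuous_scaling_def
  by (metis UNIV_I topspace_euclidean inverse_positive_iff_positive right_inverse left_inverse less_irrefl)+

lemma T_image: "0 < t \<Longrightarrow> T t ` B = T (inverse t) -` B"
  by (auto simp: image_iff intro!: bexI[of _ "T (inverse t) _"])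

lemma continuous_on_T:
  assumes "0 < t" shows "continuous_on UNIV (T t)"
proof -
  have 1: "continuous_map (prod_topology euclidean (top_of_set {0<..})) euclidean (\<lambda>(x, t). T t x)"
    using scaling by (simp add: continuous_scaling_def)
  have "continuous_map euclidean (prod_topology euclidean (top_of_set {0<..})) (\<lambda>x :: 'a. (x, t))"
    using assms by (auto simp: continuous_map_pairwise o_def continuous_map_in_subtopology)
  from continuous_map_compose[OF this 1] show ?thesis by (simp add: o_def)
qed

lemma T_borel [measurable]: "0 < t \<Longrightarrow> T t \<in> borel_measurable borel"
  by (intro borel_measurable_continuous_onI continuous_on_T)

lemma open_T_image: "0 < t \<Longrightarrow> open B \<Longrightarrow> open (T t ` B)"
  unfolding T_image by (intro open_vimage continuous_on_T) auto

lemma T_image_in_ideal: "0 < t \<Longrightarrow> B \<in> \<X> \<Longrightarrow> T t ` B \<in> \<X>"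
  using scaling_consistent by (auto simp: scaling_consistent_def)

lemma emeasure_push_scaling:
  assumes "0 < t" "m \<in> configs" "A \<in> sets borel"
  shows "emeasure (push_scaling T t m) A = emeasure m (T t -` A)"
proof -
  have [measurable_cong]: "sets m = sets borel" by (rule configsD[OF assms(2)])
  show ?thesis
    unfolding push_scaling_def using assms by (subst emeasure_distr) (auto simp: configsD)
qed

lemma push_scaling_in_configs:
  assumes t: "0 < t" and m: "m \<in> configs"
  shows "push_scaling T t m \<in> configs"
proof (rule configsI)
  show "sets (push_scaling T t m) = sets borel" by (simp add: push_scaling_def)
  have v: "T t -` A \<in> sets borel" if "A \<in> sets borel" for A
    using measurable_sets[OF T_borel[OF t] that] by simp
  have i: "T t -` A \<in> \<X>" if "A \<in> \<X>" for A
    using T_image[of "inverse t" A] T_image_in_ideal[of "inverse t" A] t that by simp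
  have c: "T t x \<in> carrier_set" if "x \<in> carrier_set" for x
    using that T_image_in_ideal[OF t] by blast
  fix A :: "'a set" assume A: "A \<in> sets borel"
  show "emeasure (push_scaling T t m) A = 0" if "A \<inter> carrier_set = {}"
    unfolding emeasure_push_scaling[OF t m A]
    by (rule configsD(4)[OF m v[OF A]]) (use c that in blast)
  show "\<exists>n::nat. emeasure (push_scaling T t m) A = of_nat n" if "A \<in> \<X>"
    unfolding emeasure_push_scaling[OF t m A] by (rule configsD(5)[OF m i[OF that] v[OF A]])
qed

lemma continuous_map_push_scaling:
  assumes t: "0 < t"
  shows "continuous_map (counting_space \<X>) (counting_space \<X>) (push_scaling T t)"
proof (rule continuous_map_counting_spaceI)
  show "push_scaling T t m \<in> configs" if "m \<in> topspace (counting_space \<X>)" for m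
    using push_scaling_in_configs[OF t] that by simp
  fix \<phi> assume \<phi>: "\<phi> \<in> ideal_test_functions euclidean \<X>"
  have test: "(\<lambda>x. \<phi> (T t x)) \<in> ideal_test_functions euclidean \<X>"
    unfolding test_functions_iff
  proof (intro conjI)
    show "continuous_on UNIV (\<lambda>x. \<phi> (T t x))"
      using \<phi> by (intro continuous_on_compose2[OF _ continuous_on_T[OF t]]) (auto simp: test_functions_iff)
    show "bounded (range (\<lambda>x. \<phi> (T t x)))"
      using \<phi> by (auto simp: test_functions_iff bounded_iff)
    have "{x. \<phi> (T t x) \<noteq> 0} \<subseteq> T (inverse t) ` closure {x. \<phi> x \<noteq> 0}"
      using T_image[of "inverse t"] t closure_subset[of "{x. \<phi> x \<noteq> 0}"] by auto
    moreover have "T (inverse t) ` closure {x. \<phi> x \<noteq> 0} \<in> \<X>"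
      using \<phi> t by (intro T_image_in_ideal) (auto simp: test_functions_iff)
    ultimately show "closure {x. \<phi> (T t x) \<noteq> 0} \<in> \<X>"
      using ideal_closure ideal_subset by blast
  qed
  have "(\<integral>x. \<phi> (T t x) \<partial>m) = (\<integral>x. \<phi> x \<partial>push_scaling T t m)" if "m \<in> configs" for m
  proof -
    have [measurable_cong]: "sets m = sets borel" by (rule configsD[OF that])
    show ?thesis
      unfolding push_scaling_def using test_function_borel_measurable[OF \<phi>] t by (subst integral_distr) auto
  qed
  then show "continuous_map (counting_space \<X>) euclideanreal (\<lambda>m. \<integral>x. \<phi> x \<partial>push_scaling T t m)"
    by (intro continuous_map_eq[OF continuous_map_integral[OF test]]) auto
qed

text \<open>Scaling back the points seen in \<open>T t ` B\<close> yields the points of the rescaled configuration in \<open>B\<close>.\<close>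
lemma restrict_config_push_scaling:
  fixes y :: "'k::finite \<Rightarrow> 'a"
  assumes t: "0 < t" and m: "m \<in> configs" and B: "B \<in> sets borel"
    and eq: "restrict_config (T t ` B) m = dirac_sum UNIV y"
  shows "restrict_config B (push_scaling T (inverse t) m) = dirac_sum UNIV (\<lambda>j. T (inverse t) (y j))"
proof (rule measure_eqI)
  have t': "0 < inverse t" using t by simp
  have v: "T (inverse t) -` A \<in> sets borel" if "A \<in> sets borel" for A
    using measurable_sets[OF T_borel[OF t'] that] by simp
  show "sets (restrict_config B (push_scaling T (inverse t) m)) = sets (dirac_sum UNIV (\<lambda>j. T (inverse t) (y j)))"
    by (simp add: push_scaling_def)
  fix A assume "A \<in> sets (restrict_config B (push_scaling T (inverse t) m))"
  then have A: "A \<in> sets borel" by (simp add: push_scaling_def)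
  have "emeasure (restrict_config B (push_scaling T (inverse t) m)) A = emeasure (push_scaling T (inverse t) m) (A \<inter> B)"
    using A B by (intro emeasure_restrict_config) (auto simp: push_scaling_def)
  also have "\<dots> = emeasure m (T (inverse t) -` A \<inter> T t ` B)"
    using A B by (simp add: emeasure_push_scaling[OF t' m] T_image[OF t])
  also have "\<dots> = emeasure (restrict_config (T t ` B) m) (T (inverse t) -` A)"
    using v[OF A] v[OF B] by (intro emeasure_restrict_config[symmetric]) (auto simp: configsD(1)[OF m] T_image[OF t])
  also have "\<dots> = emeasure (dirac_sum UNIV (\<lambda>j. T (inverse t) (y j))) A"
    unfolding eq using A v[OF A] by (simp add: emeasure_dirac_sum_finite)
  finally show "emeasure (restrict_config B (push_scaling T (inverse t) m)) A
      = emeasure (dirac_sum UNIV (\<lambda>j. T (inverse t) (y j))) A" .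
qed

end

context based_ideal begin

section \<open>Measures on the power of the space\<close>

lemma Union_power_ideal:
  "\<Union>(power_ideal \<X>) = (set_power carrier_set :: ('k::finite \<Rightarrow> 'a) set)"
proof (intro equalityI subsetI)
  fix x :: "'k \<Rightarrow> 'a" assume "x \<in> \<Union>(power_ideal \<X>)"
  then show "x \<in> set_power carrier_set" by (auto simp: power_ideal_def set_power_def)
next
  fix x :: "'k \<Rightarrow> 'a" assume "x \<in> set_power carrier_set"
  then have "range x \<subseteq> carrier_set" by (auto simp: set_power_def)
  then obtain i where "range x \<subseteq> U i" using finite_subset_base[of "range x"] by auto
  then have "x \<in> set_power (U i)" by (auto simp: set_power_def)
  then show "x \<in> \<Union>(power_ideal \<X>)" unfolding power_ideal_def by (intro UnionI[of "set_power (U i)"]) auto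
qed

lemma power_measuresD:
  fixes \<mu> :: "('k::finite \<Rightarrow> 'a) measure"
  assumes "\<mu> \<in> ideal_measures euclidean (power_ideal \<X>)"
  shows "sets \<mu> = sets borel" "space \<mu> = UNIV"
    "B \<in> \<X> \<Longrightarrow> B \<in> sets borel \<Longrightarrow> emeasure \<mu> (set_power B) < \<infinity>"
    "A \<in> sets borel \<Longrightarrow> A \<inter> set_power carrier_set = {} \<Longrightarrow> emeasure \<mu> A = 0"
proof -
  show "sets \<mu> = sets borel" using assms by (auto simp: ideal_measures_def)
  from sets_eq_imp_space_eq[OF this] show "space \<mu> = UNIV" by simp
  show "emeasure \<mu> (set_power B) < \<infinity>" if B: "B \<in> \<X>" "B \<in> sets borel"
  proof -
    have "(set_power B :: ('k \<Rightarrow> 'a) set) \<in> power_ideal \<X> \<inter> sets borel"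
      using B set_power_borel[OF B(2)] by (auto simp: power_ideal_def)
    then show ?thesis using assms by (auto simp: ideal_measures_def)
  qed
  show "emeasure \<mu> A = 0" if "A \<in> sets borel" "A \<inter> set_power carrier_set = {}"
    using assms that by (simp add: ideal_measures_def Union_power_ideal)
qed

lemma integrable_power_measure:
  fixes h :: "('k::finite \<Rightarrow> 'a) \<Rightarrow> real"
  assumes \<mu>: "\<mu> \<in> ideal_measures euclidean (power_ideal \<X>)"
    and h: "h \<in> borel_measurable borel" "\<And>x. \<bar>h x\<bar> \<le> M"
    and B: "B \<in> \<X>" "B \<in> sets borel" "\<And>x. x \<notin> set_power B \<Longrightarrow> h x = 0"
  shows "integrable \<mu> h"
proof (rule integrableI_bounded_set[where A="set_power B" and B=M])
  show "h \<in> borel_measurable \<mu>"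
    using h(1) measurable_cong_sets[OF power_measuresD(1)[OF \<mu>] refl] by blast
  show "set_power B \<in> sets \<mu>" using set_power_borel[OF B(2)] power_measuresD(1)[OF \<mu>] by simp
qed (use h B power_measuresD(3)[OF \<mu>] in auto)

lemma dirac_sum_emeasure_ge_iff:
  fixes x :: "'k::finite \<Rightarrow> 'a"
  assumes "A \<in> sets borel"
  shows "of_nat CARD('k) \<le> emeasure (dirac_sum UNIV x) A \<longleftrightarrow> x \<in> set_power A"
proof -
  have "of_nat CARD('k) \<le> emeasure (dirac_sum UNIV x) A \<longleftrightarrow> CARD('k) \<le> card {i. x i \<in> A}"
    using assms by (simp add: emeasure_dirac_sum_finite)
  also have "\<dots> \<longleftrightarrow> {i. x i \<in> A} = UNIV"
    using card_seteq[of UNIV "{i. x i \<in> A}"] by auto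
  finally show ?thesis by (auto simp: set_power_def)
qed

end

section \<open>Lower and upper bounds for the rescaled process\<close>

locale janossy_convergence = scaled_ideal \<X> U T + prob_space P
  for \<X> :: "'a::polish_space set set" and U T and P :: "'w measure" +
  fixes \<eta> :: "'w \<Rightarrow> 'a measure" and g :: "real \<Rightarrow> real" and \<mu> :: "('k::finite \<Rightarrow> 'a) measure"
  assumes \<eta> [measurable]: "\<eta> \<in> measurable P (borel_on (counting_space \<X>))"
    and g_nonneg: "\<And>t. 0 \<le> t \<Longrightarrow> 0 \<le> g t"
    and \<mu>: "\<mu> \<in> ideal_measures euclidean (power_ideal \<X>)"
    and janossy_limit: "\<And>B h. B \<in> \<X> \<Longrightarrow> B \<in> sets borel \<Longrightarrow> continuous_on UNIV h \<Longrightarrow> bounded (range h) \<Longrightarrow>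
           closure {x. h x \<noteq> 0} \<subseteq> set_power B \<Longrightarrow>
           ((\<lambda>t. g t * (\<integral>x. h (\<lambda>j. T (inverse t) (x j)) \<partial>janossy_measure P \<eta> (T t ` B)))
              \<longlongrightarrow> (\<integral>x. h x \<partial>\<mu>)) at_top"
    and excess_limit: "\<And>i. ((\<lambda>t. g t * measure P {\<omega> \<in> space P.
                    emeasure (\<eta> \<omega>) (T t ` U i) \<ge> of_nat (CARD('k) + 1)}) \<longlongrightarrow> 0) at_top"
begin

abbreviation rescaled :: "real \<Rightarrow> 'w \<Rightarrow> 'a measure" where
  "rescaled t \<omega> \<equiv> push_scaling T (inverse t) (\<eta> \<omega>)"

lemma \<eta>_in_configs: "\<omega> \<in> space P \<Longrightarrow> \<eta> \<omega> \<in> configs"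
  using measurable_space[OF \<eta>] by simp

lemma rescaled_in_configs: "0 < t \<Longrightarrow> \<omega> \<in> space P \<Longrightarrow> rescaled t \<omega> \<in> configs"
  by (intro push_scaling_in_configs \<eta>_in_configs) auto

lemma borel_measurable_rescaled:
  fixes F :: "'a measure \<Rightarrow> real"
  assumes "0 < t" and "continuous_map (subtopology (counting_space \<X>) (\<Union>(counting_ideal CARD('k) \<X>))) euclideanreal F"
    and "\<And>m. m \<notin> (\<Union>(counting_ideal CARD('k) \<X>)) \<Longrightarrow> F m = 0"
  shows "(\<lambda>\<omega>. F (rescaled t \<omega>)) \<in> borel_measurable P"
proof -
  have p: "push_scaling T (inverse t) \<in> measurable (borel_on (counting_space \<X>)) (borel_on (counting_space \<X>))"
    using assms(1) by (intro measurable_borel_on_continuous_map continuous_map_push_scaling) simp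
  have F: "F \<in> borel_measurable (borel_on (counting_space \<X>))"
    by (rule borel_measurable_zero_extension[OF openin_Union_counting_ideal assms(2,3)])
  show ?thesis by (rule measurable_compose[OF \<eta> measurable_compose[OF p F]])
qed

lemma borel_measurable_rescale_points:
  fixes h :: "('k \<Rightarrow> 'a) \<Rightarrow> real"
  assumes "0 < t" "h \<in> borel_measurable borel"
  shows "(\<lambda>x. h (\<lambda>j. T (inverse t) (x j))) \<in> borel_measurable borel"
proof -
  have "continuous_on UNIV (\<lambda>x :: 'k \<Rightarrow> 'a. \<lambda>j. T (inverse t) (x j))"
  proof (rule continuous_on_coordinatewise_then_product)
    fix j :: 'k
    show "continuous_on UNIV (\<lambda>x :: 'k \<Rightarrow> 'a. T (inverse t) (x j))"
      by (rule continuous_on_compose2[OF continuous_on_T continuous_on_product_coordinates]) (use assms in auto)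
  qed
  from measurable_compose[OF borel_measurable_continuous_onI[OF this] assms(2)] show ?thesis .
qed

lemma integral_janossy_rescaled:
  fixes h :: "('k \<Rightarrow> 'a) \<Rightarrow> real"
  assumes t: "0 < t" and V: "open V" "V \<in> \<X>" and h: "h \<in> borel_measurable borel" "\<And>x. 0 \<le> h x" "\<And>x. h x \<le> C"
  shows "(\<integral>x. h (\<lambda>j. T (inverse t) (x j)) \<partial>janossy_measure P \<eta> (T t ` V))
    = (\<integral>\<omega>. (\<integral>x. h (\<lambda>j. T (inverse t) (x j)) \<partial>ordering_kernel (T t ` V) (\<eta> \<omega>)) \<partial>P)"
    "integrable P (\<lambda>\<omega>. \<integral>x. h (\<lambda>j. T (inverse t) (x j)) \<partial>ordering_kernel (T t ` V) (\<eta> \<omega>))"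
proof -
  note hm = borel_measurable_rescale_points[OF t h(1)]
  note V' = open_T_image[OF t V(1)] T_image_in_ideal[OF t V(2)]
  have C0: "0 \<le> C" using h(2,3) by (rule order_trans)
  show "(\<integral>x. h (\<lambda>j. T (inverse t) (x j)) \<partial>janossy_measure P \<eta> (T t ` V))
    = (\<integral>\<omega>. (\<integral>x. h (\<lambda>j. T (inverse t) (x j)) \<partial>ordering_kernel (T t ` V) (\<eta> \<omega>)) \<partial>P)"
    using h(2,3) by (intro integral_janossy_measure[OF prob_space_axioms \<eta> V' hm, of C]) auto
  show "integrable P (\<lambda>\<omega>. \<integral>x. h (\<lambda>j. T (inverse t) (x j)) \<partial>ordering_kernel (T t ` V) (\<eta> \<omega>))"
  proof (rule integrable_const_bound[of _ C])
    show "AE \<omega> in P. norm (\<integral>x. h (\<lambda>j. T (inverse t) (x j)) \<partial>ordering_kernel (T t ` V) (\<eta> \<omega>)) \<le> C"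
    proof (rule AE_I2)
      fix \<omega> assume \<omega>: "\<omega> \<in> space P"
      have "(\<integral>x. h (\<lambda>j. T (inverse t) (x j)) \<partial>ordering_kernel (T t ` V) (\<eta> \<omega>)) \<le> C"
        using h(2,3) C0 V' by (intro integral_ordering_kernel_le[OF \<eta>_in_configs[OF \<omega>] _ _ hm]) auto
      moreover have "0 \<le> (\<integral>x. h (\<lambda>j. T (inverse t) (x j)) \<partial>ordering_kernel (T t ` V) (\<eta> \<omega>))"
        using h(2) by simp
      ultimately show "norm (\<integral>x. h (\<lambda>j. T (inverse t) (x j)) \<partial>ordering_kernel (T t ` V) (\<eta> \<omega>)) \<le> C"
        by simp
    qed
  qed (rule measurable_integral_ordering_kernel[OF \<eta> V' hm])
qed

text \<open>This is one half of a portmanteau theorem.  By Fatou's lemma one of the approximations \<open>h n\<close> from below already has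
  \<open>\<mu>\<close>-integral above \<open>c\<close>, and its rescaled Janossy integrals converge.  They bound \<open>g t\<close> times the
  expectation of \<open>F\<close> from below, because \<open>h n\<close> is below \<open>F\<close> for every configuration with \<open>k\<close> points in the window
  and \<open>F\<close> is nonnegative elsewhere.\<close>
lemma eventually_greater_than_below_limit:
  fixes F :: "'a measure \<Rightarrow> real"
  assumes F: "continuous_map (subtopology (counting_space \<X>) (\<Union>(counting_ideal CARD('k) \<X>))) euclideanreal F"
    and F0: "\<And>m. 0 \<le> F m" and FM: "\<And>m. F m \<le> M" and Fz: "\<And>m. m \<notin> (\<Union>(counting_ideal CARD('k) \<X>)) \<Longrightarrow> F m = 0"
    and int: "integrable \<mu> (\<lambda>x. F (dirac_sum UNIV x))"
    and c: "c < (\<integral>x. F (dirac_sum UNIV x) \<partial>\<mu>)"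
  shows "\<forall>\<^sub>F t in at_top. c < g t * (\<integral>\<omega>. F (rescaled t \<omega>) \<partial>P)"
proof (cases "0 \<le> c")
  case False
  have "\<forall>\<^sub>F t :: real in at_top. 0 \<le> t" by (rule eventually_ge_at_top)
  then show ?thesis
  proof eventually_elim
    case (elim t)
    have "0 \<le> g t * (\<integral>\<omega>. F (rescaled t \<omega>) \<partial>P)"
      using F0 g_nonneg[OF elim] by (intro mult_nonneg_nonneg integral_nonneg_AE) auto
    then show ?case using False by simp
  qed
next
  case True
  obtain h where h: "\<And>n. continuous_on UNIV (h n)" "\<And>n x. 0 \<le> h n x" "\<And>n x. h n x \<le> M"
    "\<And>n x. x \<notin> set_power (window n) \<Longrightarrow> h n x = 0"
    "\<And>n m x. m \<in> configs \<Longrightarrow> restrict_config (window n) m = dirac_sum UNIV x \<Longrightarrow> h n x \<le> F m"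
    "\<And>x c. x \<in> set_power carrier_set \<Longrightarrow> c < F (dirac_sum UNIV (x :: 'k \<Rightarrow> 'a)) \<Longrightarrow> \<forall>\<^sub>F n in sequentially. c < h n x"
    by (rule lower_approximation[OF F F0 FM]) (rule that; assumption)
  have hm: "h n \<in> borel_measurable borel" for n by (rule borel_measurable_continuous_onI[OF h(1)])
  then have hm'[measurable]: "h n \<in> borel_measurable \<mu>" for n
    using measurable_cong_sets[OF power_measuresD(1)[OF \<mu>] refl] by blast
  have hint: "integrable \<mu> (h n)" for n
    by (rule integrable_power_measure[OF \<mu> hm, where M=M and B="window n"]) (use h(2,3,4) in auto)
  have pw: "ennreal (F (dirac_sum UNIV x)) \<le> liminf (\<lambda>n. ennreal (h n x))" for x
  proof (cases "x \<in> set_power carrier_set")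
    case True
    show ?thesis
    proof (rule le_Liminf_iff[THEN iffD2], intro allI impI)
      fix y :: ennreal assume y: "y < ennreal (F (dirac_sum UNIV x))"
      then obtain r where r: "y = ennreal r" "0 \<le> r" by (cases y) auto
      then have "r < F (dirac_sum UNIV x)" using y F0 by (simp add: ennreal_less_iff)
      from h(6)[OF True this] show "\<forall>\<^sub>F n in sequentially. y < ennreal (h n x)"
        by (rule eventually_mono) (use r in \<open>simp add: ennreal_less_iff\<close>)
    qed
  next
    case False
    then have "dirac_sum UNIV x \<notin> configs" by (simp add: dirac_sum_in_configs_iff)
    then have "F (dirac_sum UNIV x) = 0" by (intro Fz) (auto simp: counting_ideal_def)
    then show ?thesis by simp
  qed
  have "ennreal c < ennreal (\<integral>x. F (dirac_sum UNIV x) \<partial>\<mu>)" using c True by (simp add: ennreal_less_iff)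
  also have "\<dots> = (\<integral>\<^sup>+x. ennreal (F (dirac_sum UNIV x)) \<partial>\<mu>)"
    using F0 by (intro nn_integral_eq_integral[OF int, symmetric]) auto
  also have "\<dots> \<le> (\<integral>\<^sup>+x. liminf (\<lambda>n. ennreal (h n x)) \<partial>\<mu>)" using pw by (intro nn_integral_mono) auto
  also have "\<dots> \<le> liminf (\<lambda>n. \<integral>\<^sup>+x. ennreal (h n x) \<partial>\<mu>)" by (intro nn_integral_liminf) auto
  finally have "\<forall>\<^sub>F n in sequentially. ennreal c < (\<integral>\<^sup>+x. ennreal (h n x) \<partial>\<mu>)" by (rule less_LiminfD)
  then obtain n where "ennreal c < (\<integral>\<^sup>+x. ennreal (h n x) \<partial>\<mu>)"
    by (auto simp: eventually_sequentially)
  also have "\<dots> = ennreal (\<integral>x. h n x \<partial>\<mu>)"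
    using h(2) by (intro nn_integral_eq_integral[OF hint]) auto
  finally have n: "c < (\<integral>x. h n x \<partial>\<mu>)" using True by (simp add: ennreal_less_iff)
  \<comment> \<open>the closed support of \<open>h n\<close> may leave the window, so the Janossy measure is taken in a larger set\<close>
  obtain i where i: "closure (window n) \<subseteq> U i" using ideal_base[OF ideal_closure[OF window_in_ideal]] by auto
  let ?J = "\<lambda>t. (\<integral>x. h n (\<lambda>j. T (inverse t) (x j)) \<partial>janossy_measure P \<eta> (T t ` U i))"
  have "((\<lambda>t. g t * ?J t) \<longlongrightarrow> (\<integral>x. h n x \<partial>\<mu>)) at_top"
  proof (rule janossy_limit)
    show "bounded (range (h n))" using h(2,3) by (intro boundedI[of _ M]) auto
    have "{x. h n x \<noteq> 0} \<subseteq> set_power (window n)" using h(4) by auto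
    then have "closure {x. h n x \<noteq> 0} \<subseteq> set_power (closure (window n))"
      by (rule subset_trans[OF closure_mono closure_set_power_subset])
    then show "closure {x. h n x \<noteq> 0} \<subseteq> set_power (U i)" using i by (auto simp: set_power_def)
  qed (use h in auto)
  then have "\<forall>\<^sub>F t in at_top. c < g t * ?J t" using n by (rule order_tendstoD(1))
  moreover have "\<forall>\<^sub>F t :: real in at_top. 0 < t" by (rule eventually_gt_at_top)
  ultimately show ?thesis
  proof eventually_elim
    case (elim t)
    note t = elim(2)
    note W = open_T_image[OF t open_U[of i]] T_image_in_ideal[OF t U_in_ideal[of i]]
    have "?J t = (\<integral>\<omega>. (\<integral>x. h n (\<lambda>j. T (inverse t) (x j)) \<partial>ordering_kernel (T t ` U i) (\<eta> \<omega>)) \<partial>P)"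
      by (rule integral_janossy_rescaled[OF t open_U U_in_ideal hm h(2,3)])
    also have "\<dots> \<le> (\<integral>\<omega>. F (rescaled t \<omega>) \<partial>P)"
    proof (rule integral_mono)
      show "integrable P (\<lambda>\<omega>. \<integral>x. h n (\<lambda>j. T (inverse t) (x j)) \<partial>ordering_kernel (T t ` U i) (\<eta> \<omega>))"
        by (rule integral_janossy_rescaled[OF t open_U U_in_ideal hm h(2,3)])
      show "integrable P (\<lambda>\<omega>. F (rescaled t \<omega>))"
        using F0 FM by (intro integrable_const_bound[of _ M] borel_measurable_rescaled[OF t F Fz]) auto
      fix \<omega> assume \<omega>: "\<omega> \<in> space P"
      note m = \<eta>_in_configs[OF \<omega>] and m' = rescaled_in_configs[OF t \<omega>]
      show "(\<integral>x. h n (\<lambda>j. T (inverse t) (x j)) \<partial>ordering_kernel (T t ` U i) (\<eta> \<omega>)) \<le> F (rescaled t \<omega>)"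
      proof (rule integral_ordering_kernel_le[OF m W(2)])
        fix y :: "'k \<Rightarrow> 'a" assume "restrict_config (T t ` U i) (\<eta> \<omega>) = dirac_sum UNIV y"
        then have z: "restrict_config (U i) (rescaled t \<omega>) = dirac_sum UNIV (\<lambda>j. T (inverse t) (y j))"
          by (intro restrict_config_push_scaling[OF t m]) auto
        show "h n (\<lambda>j. T (inverse t) (y j)) \<le> F (rescaled t \<omega>)"
        proof (cases "(\<lambda>j. T (inverse t) (y j)) \<in> set_power (window n)")
          case True
          have "restrict_config (window n) (rescaled t \<omega>) = dirac_sum UNIV (\<lambda>j. T (inverse t) (y j))"
            using i closure_subset[of "window n"] configsD(1)[OF m'] True
            by (intro restrict_config_listingD(2)[OF z]) auto
          then show ?thesis by (rule h(5)[OF m'])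
        qed (use h(4) F0 in auto)
      qed (use W h(2) F0 borel_measurable_rescale_points[OF t hm] in auto)
    qed
    finally have "g t * ?J t \<le> g t * (\<integral>\<omega>. F (rescaled t \<omega>) \<partial>P)"
      using g_nonneg[of t] t by (intro mult_left_mono) auto
    then show ?case using elim(1) by simp
  qed
qed

text \<open>The function is \<open>\<psi> m = cl (\<integral>\<phi> dm)\<close> for a cutoff \<open>\<phi>\<close> that equals 1 on the closure of \<open>A\<close>, where \<open>cl\<close> vanishes up to
  \<open>k - 1/2\<close> and equals 1 from \<open>k\<close> on.  A configuration with at most \<open>k - 1\<close> points in the window has
  \<open>\<integral>\<phi> dm \<le> k - 1\<close>, so \<open>\<psi>\<close> and the Janossy integrand differ only if there are more than \<open>k\<close> points.\<close>
lemma dominating_function_exists: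
  assumes A: "A \<in> \<X>" "A \<in> sets borel"
  obtains \<psi> :: "'a measure \<Rightarrow> real" where
    "continuous_map (subtopology (counting_space \<X>) (\<Union>(counting_ideal CARD('k) \<X>))) euclideanreal \<psi>"
    "\<And>m. 0 \<le> \<psi> m" "\<And>m. \<psi> m \<le> 1" "\<And>m. m \<notin> (\<Union>(counting_ideal CARD('k) \<X>)) \<Longrightarrow> \<psi> m = 0"
    "\<And>m. m \<in> configs \<Longrightarrow> of_nat CARD('k) \<le> emeasure m A \<Longrightarrow> \<psi> m = 1"
    "integrable \<mu> (\<lambda>x. \<psi> (dirac_sum UNIV x))"
    "((\<lambda>t. g t * (\<integral>\<omega>. \<psi> (rescaled t \<omega>) \<partial>P)) \<longlongrightarrow> (\<integral>x. \<psi> (dirac_sum UNIV x) \<partial>\<mu>)) at_top"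
proof -
  obtain a where a: "closure A \<subseteq> U a" using ideal_base[OF ideal_closure[OF A(1)]] by auto
  obtain i where i: "closure (U a) \<subseteq> U i" using ideal_base[OF ideal_closure[OF U_in_ideal]] by auto
  have Uai: "U a \<subseteq> U i" using i closure_subset by blast
  obtain \<phi> where \<phi>: "\<phi> \<in> ideal_test_functions euclidean \<X>"
    "\<And>x. 0 \<le> \<phi> x" "\<And>x. \<phi> x \<le> 1" "\<And>x. x \<in> closure A \<Longrightarrow> \<phi> x = 1" "\<And>x. x \<notin> U a \<Longrightarrow> \<phi> x = 0"
    using cutoff_function_exists[OF closed_closure open_U a U_in_ideal] by metis
  define cl :: "real \<Rightarrow> real" where "cl s = max 0 (min 1 (2 * s - (2 * real CARD('k) - 1)))" for s
  have cl01: "0 \<le> cl s" "cl s \<le> 1" for s by (auto simp: cl_def)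
  have cl0: "cl s = 0" if "s \<le> real CARD('k) - 1" for s using that by (auto simp: cl_def)
  have ccl: "continuous_on UNIV cl" unfolding cl_def by (intro continuous_intros)
  define \<psi> where "\<psi> m = (if m \<in> configs then cl (\<integral>x. \<phi> x \<partial>m) else 0)" for m
  define h where "h x = cl (\<Sum>j\<in>UNIV. \<phi> (x j))" for x :: "'k \<Rightarrow> 'a"
  have \<phi>m[measurable]: "\<phi> \<in> borel_measurable borel" by (rule test_function_borel_measurable[OF \<phi>(1)])
  have ch: "continuous_on UNIV h"
    unfolding h_def using \<phi>(1) by (intro continuous_on_compose2[OF ccl continuous_on_sum_coordinates])
      (auto simp: test_functions_iff)
  have hm: "h \<in> borel_measurable borel" by (rule borel_measurable_continuous_onI[OF ch])
  have hz: "h x = 0" if "x \<notin> set_power (U a)" for x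
  proof -
    obtain j0 where "\<phi> (x j0) = 0" using \<phi>(5) \<open>x \<notin> set_power (U a)\<close> by (auto simp: set_power_def)
    then have "(\<Sum>j\<in>UNIV. \<phi> (x j)) = (\<Sum>j\<in>UNIV - {j0}. \<phi> (x j))"
      by (simp add: sum.remove[of UNIV j0])
    also have "\<dots> \<le> of_nat (card (UNIV - {j0})) * 1" using \<phi>(3) by (intro sum_bounded_above) auto
    also have "\<dots> = real CARD('k) - 1" by (simp add: card_Diff_singleton of_nat_diff)
    finally show ?thesis unfolding h_def by (rule cl0)
  qed
  have \<psi>0: "\<psi> m = 0" if "m \<in> configs" "emeasure m (U i) = of_nat l" "l < CARD('k)" for m l
  proof -
    have "(\<integral>x. \<phi> x \<partial>m) \<le> measure m (U i)"
      using \<phi>(3,5) Uai by (intro integral_le_measure[OF \<phi>(1) that(1)]) auto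
    also have "\<dots> = real l" using that(2) by (simp add: measure_def)
    also have "\<dots> \<le> real CARD('k) - 1" using that(3) by linarith
    finally show ?thesis using that(1) by (simp add: \<psi>_def cl0)
  qed
  have \<psi>_test: "\<psi> m = h y" if m: "m \<in> configs" and y: "restrict_config (U i) m = dirac_sum UNIV y" for m y
  proof -
    have [measurable_cong]: "sets m = sets borel" by (rule configsD(1)[OF m])
    have "(\<integral>x. \<phi> x \<partial>m) = (\<integral>x. \<phi> x \<partial>restrict_config (U i) m)"
      using \<phi>(5) Uai by (intro integral_restrict_config[symmetric]) auto
    then show ?thesis using m by (simp add: \<psi>_def h_def y integral_dirac_sum)
  qed
  have \<psi>h: "\<psi> (dirac_sum UNIV x) = h x" for x :: "'k \<Rightarrow> 'a"
  proof (cases "x \<in> set_power carrier_set")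
    case True
    then show ?thesis by (simp add: \<psi>_def h_def dirac_sum_in_configs_iff integral_dirac_sum)
  next
    case False
    then have "x \<notin> set_power (U a)" using U_in_ideal[of a] by (auto simp: set_power_def)
    then show ?thesis using False by (simp add: \<psi>_def dirac_sum_in_configs_iff hz)
  qed
  have c\<psi>: "continuous_map (counting_space \<X>) euclideanreal \<psi>"
  proof -
    have "continuous_map (counting_space \<X>) euclideanreal (cl \<circ> (\<lambda>m. \<integral>x. \<phi> x \<partial>m))"
      using continuous_map_integral[OF \<phi>(1)] ccl by (intro continuous_map_compose) auto
    then show ?thesis by (rule continuous_map_eq) (simp add: \<psi>_def)
  qed
  have \<psi>z: "\<psi> m = 0" if "m \<notin> (\<Union>(counting_ideal CARD('k) \<X>))" for m
  proof (cases "m \<in> configs")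
    case True
    obtain l :: nat where l: "emeasure m (U i) = of_nat l" using configsD(5)[OF True, of "U i"] by auto
    have "\<not> of_nat CARD('k) \<le> emeasure m (U i)" using that True unfolding Union_counting_ideal by auto
    then show ?thesis using \<psi>0[OF True l] l by simp
  qed (simp add: \<psi>_def)
  show thesis
  proof (rule that[of \<psi>])
    show c1: "continuous_map (subtopology (counting_space \<X>) (\<Union>(counting_ideal CARD('k) \<X>))) euclideanreal \<psi>"
      by (rule continuous_map_from_subtopology[OF c\<psi>])
    show "0 \<le> \<psi> m" "\<psi> m \<le> 1" for m using cl01 by (auto simp: \<psi>_def)
    show "\<psi> m = 0" if "m \<notin> (\<Union>(counting_ideal CARD('k) \<X>))" for m by (rule \<psi>z[OF that])
    show "\<psi> m = 1" if m: "m \<in> configs" and k: "of_nat CARD('k) \<le> emeasure m A" for m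
    proof -
      have "real CARD('k) \<le> measure m A"
      proof -
        obtain l :: nat where "emeasure m A = of_nat l" using configsD(5)[OF m A] by auto
        then show ?thesis using k by (simp add: measure_def)
      qed
      also have "\<dots> \<le> (\<integral>x. \<phi> x \<partial>m)"
        using \<phi>(2,4) closure_subset[of A] A by (intro measure_le_integral[OF \<phi>(1) m]) auto
      finally show ?thesis using m by (simp add: \<psi>_def cl_def)
    qed
    have h01: "0 \<le> h x" "h x \<le> 1" for x unfolding h_def by (rule cl01)+
    show "integrable \<mu> (\<lambda>x. \<psi> (dirac_sum UNIV x))"
      unfolding \<psi>h by (rule integrable_power_measure[OF \<mu> hm, where M=1 and B="U a"]) (use h01 hz in auto)
    let ?J = "\<lambda>t. (\<integral>x. h (\<lambda>j. T (inverse t) (x j)) \<partial>janossy_measure P \<eta> (T t ` U i))"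
    let ?E = "\<lambda>t. {\<omega> \<in> space P. emeasure (\<eta> \<omega>) (T t ` U i) \<ge> of_nat (CARD('k) + 1)}"
    have lim: "((\<lambda>t. g t * ?J t) \<longlongrightarrow> (\<integral>x. h x \<partial>\<mu>)) at_top"
    proof (rule janossy_limit)
      show "bounded (range h)" using h01 by (intro boundedI[of _ 1]) auto
      have "{x. h x \<noteq> 0} \<subseteq> set_power (U a)" using hz by auto
      then have "closure {x. h x \<noteq> 0} \<subseteq> set_power (closure (U a))"
        by (rule subset_trans[OF closure_mono closure_set_power_subset])
      then show "closure {x. h x \<noteq> 0} \<subseteq> set_power (U i)" using i by (auto simp: set_power_def)
    qed (use ch in auto)
    have close: "\<bar>g t * (\<integral>\<omega>. \<psi> (rescaled t \<omega>) \<partial>P) - g t * ?J t\<bar> \<le> g t * measure P (?E t)" if t: "0 < t" for t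
    proof -
      note W = open_T_image[OF t open_U[of i]] T_image_in_ideal[OF t U_in_ideal[of i]]
      let ?K = "\<lambda>\<omega>. \<integral>x. h (\<lambda>j. T (inverse t) (x j)) \<partial>ordering_kernel (T t ` U i) (\<eta> \<omega>)"
      note J = integral_janossy_rescaled[OF t open_U U_in_ideal hm h01]
      note hm' = borel_measurable_rescale_points[OF t hm]
      have i\<psi>: "integrable P (\<lambda>\<omega>. \<psi> (rescaled t \<omega>))"
        using cl01 by (intro integrable_const_bound[of _ 1] borel_measurable_rescaled[OF t c1 \<psi>z])
          (auto simp: \<psi>_def)
      have E: "?E t \<in> sets P"
      proof -
        have "(\<lambda>\<omega>. emeasure (\<eta> \<omega>) (T t ` U i)) \<in> borel_measurable P"
          using measurable_compose[OF \<eta> measurable_emeasure_config[OF W, of UNIV]] by simp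
        then show ?thesis by measurable
      qed
      have pw: "\<bar>\<psi> (rescaled t \<omega>) - ?K \<omega>\<bar> \<le> indicator (?E t) \<omega>" if \<omega>: "\<omega> \<in> space P" for \<omega>
      proof -
        note m = \<eta>_in_configs[OF \<omega>] and m' = rescaled_in_configs[OF t \<omega>]
        have Wm: "T t ` U i \<in> sets borel" using W by auto
        obtain l :: nat where l: "emeasure (\<eta> \<omega>) (T t ` U i) = of_nat l" using configsD(5)[OF m W(2) Wm] by auto
        have eq: "emeasure (rescaled t \<omega>) (U i) = of_nat l"
          using t by (simp add: emeasure_push_scaling[OF _ m] T_image[OF t, symmetric] l)
        have K01: "0 \<le> ?K \<omega>" "?K \<omega> \<le> 1"
          using h01 integral_ordering_kernel_le[OF m W(2) Wm hm', of 1] by auto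
        have \<psi>01: "0 \<le> \<psi> (rescaled t \<omega>)" "\<psi> (rescaled t \<omega>) \<le> 1" using cl01 by (auto simp: \<psi>_def)
        \<comment> \<open>the two sides agree unless the window contains more than \<open>k\<close> points\<close>
        consider "l < CARD('k)" | "l = CARD('k)" | "CARD('k) + 1 \<le> l" by linarith
        then show ?thesis
        proof cases
          case 1
          then have "?K \<omega> = 0" using integral_ordering_kernel[OF m W(2) Wm hm'] h01 l by simp
          then show ?thesis using \<psi>0[OF m' eq 1] by simp
        next
          case 2
          have "?K \<omega> = \<psi> (rescaled t \<omega>)"
          proof (rule integral_ordering_kernel_eq[OF m W(2) Wm hm'])
            fix y :: "'k \<Rightarrow> 'a" assume "restrict_config (T t ` U i) (\<eta> \<omega>) = dirac_sum UNIV y"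
            then have "restrict_config (U i) (rescaled t \<omega>) = dirac_sum UNIV (\<lambda>j. T (inverse t) (y j))"
              by (intro restrict_config_push_scaling[OF t m]) auto
            then show "h (\<lambda>j. T (inverse t) (y j)) = \<psi> (rescaled t \<omega>)"
              by (rule \<psi>_test[OF m', symmetric])
          qed (use h01 l 2 in auto)
          then show ?thesis by simp
        next
          case 3
          then have "\<omega> \<in> ?E t" using \<omega> l by (simp del: of_nat_Suc of_nat_add)
          then show ?thesis using K01 \<psi>01 by (simp add: abs_le_iff)
        qed
      qed
      have "\<bar>(\<integral>\<omega>. \<psi> (rescaled t \<omega>) \<partial>P) - ?J t\<bar> = \<bar>\<integral>\<omega>. \<psi> (rescaled t \<omega>) - ?K \<omega> \<partial>P\<bar>"
        using i\<psi> J by simp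
      also have "\<dots> \<le> (\<integral>\<omega>. \<bar>\<psi> (rescaled t \<omega>) - ?K \<omega>\<bar> \<partial>P)"
        by (rule integral_abs_bound)
      also have "\<dots> \<le> (\<integral>\<omega>. indicator (?E t) \<omega> \<partial>P)"
        using pw i\<psi> J(2) E by (intro integral_mono) (auto simp: emeasure_eq_measure)
      also have "\<dots> = measure P (?E t)" using E by simp
      finally have "\<bar>(\<integral>\<omega>. \<psi> (rescaled t \<omega>) \<partial>P) - ?J t\<bar> \<le> measure P (?E t)" .
      then have "g t * \<bar>(\<integral>\<omega>. \<psi> (rescaled t \<omega>) \<partial>P) - ?J t\<bar> \<le> g t * measure P (?E t)"
        using g_nonneg[of t] t by (intro mult_left_mono) auto
      then show ?thesis using g_nonneg[of t] t by (simp add: abs_mult right_diff_distrib[symmetric])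
    qed
    have "((\<lambda>t. g t * (\<integral>\<omega>. \<psi> (rescaled t \<omega>) \<partial>P) - g t * ?J t) \<longlongrightarrow> 0) at_top"
      by (rule Lim_null_comparison[OF _ excess_limit[of i]])
        (use eventually_gt_at_top[of "0::real"] in eventually_elim, use close in simp)
    from tendsto_add[OF this lim]
    show "((\<lambda>t. g t * (\<integral>\<omega>. \<psi> (rescaled t \<omega>) \<partial>P)) \<longlongrightarrow> (\<integral>x. \<psi> (dirac_sum UNIV x) \<partial>\<mu>)) at_top"
      unfolding \<psi>h by simp
  qed
qed

end

section \<open>The tail measure\<close>

context based_ideal begin

context
  fixes \<mu> :: "('k::finite \<Rightarrow> 'a) measure"
  assumes \<mu>: "\<mu> \<in> ideal_measures euclidean (power_ideal \<X>)"
begin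

text \<open>The Borel sets of configurations contain no \<open>\<delta> x\<close> with a coordinate outside \<^term>\<open>\<Union>\<X>\<close>.  For this reason the
  integral that defines the tail measure is a push-forward of the restriction of \<open>\<mu>\<close>.\<close>
lemma dirac_sum_vimage_borel:
  assumes D: "D \<in> sets (borel_on (counting_space \<X>))"
  shows "{x :: 'k \<Rightarrow> 'a. dirac_sum UNIV x \<in> D} \<in> sets borel"
    and "{x :: 'k \<Rightarrow> 'a. dirac_sum UNIV x \<in> D} \<subseteq> set_power carrier_set"
proof -
  let ?O = "set_power carrier_set :: ('k \<Rightarrow> 'a) set"
  have oO: "open ?O" by (rule open_set_power[OF open_carrier_set])
  have "(dirac_sum UNIV :: ('k \<Rightarrow> 'a) \<Rightarrow> 'a measure) \<in> measurable (borel_on (top_of_set ?O)) (borel_on (counting_space \<X>))"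
    by (rule measurable_borel_on_continuous_map[OF continuous_map_dirac_sum])
  from measurable_sets[OF this D]
  have "{x \<in> ?O. dirac_sum UNIV x \<in> D} \<in> sets (borel_on (top_of_set ?O))"
    by (simp add: vimage_def Int_def conj_commute)
  moreover have "sets (borel_on (top_of_set ?O)) \<subseteq> sets borel"
    unfolding sets_borel_on using oO
    by (intro sets.sigma_sets_subset') (auto simp: openin_open intro!: borel_open)
  moreover have sub: "{x. dirac_sum UNIV x \<in> D} \<subseteq> ?O"
    using sets.sets_into_space[OF D] by (auto simp: dirac_sum_in_configs_iff[symmetric])
  moreover from sub have "{x \<in> ?O. dirac_sum UNIV x \<in> D} = {x. dirac_sum UNIV x \<in> D}" by auto
  ultimately show "{x :: 'k \<Rightarrow> 'a. dirac_sum UNIV x \<in> D} \<in> sets borel"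
    and "{x :: 'k \<Rightarrow> 'a. dirac_sum UNIV x \<in> D} \<subseteq> set_power carrier_set" by auto
qed

lemma measurable_dirac_sum_restrict:
  "dirac_sum UNIV \<in> measurable (restrict_space \<mu> (set_power carrier_set)) (borel_on (counting_space \<X>))"
proof (rule measurableI)
  fix x assume "x \<in> space (restrict_space \<mu> (set_power carrier_set))"
  then show "dirac_sum UNIV x \<in> space (borel_on (counting_space \<X>))"
    by (simp add: space_restrict_space dirac_sum_in_configs_iff)
next
  fix D assume D: "D \<in> sets (borel_on (counting_space \<X>))"
  note 1 = dirac_sum_vimage_borel[OF D]
  have "dirac_sum UNIV -` D \<inter> space (restrict_space \<mu> (set_power carrier_set)) =
      set_power carrier_set \<inter> {x :: 'k \<Rightarrow> 'a. dirac_sum UNIV x \<in> D}"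
    using power_measuresD(2)[OF \<mu>] by (auto simp: space_restrict_space)
  also have "\<dots> \<in> sets (restrict_space \<mu> (set_power carrier_set))"
    using 1(1) power_measuresD(1)[OF \<mu>] by (auto simp: sets_restrict_space)
  finally show "dirac_sum UNIV -` D \<inter> space (restrict_space \<mu> (set_power carrier_set))
      \<in> sets (restrict_space \<mu> (set_power carrier_set))" .
qed

lemma carrier_power_in_sets: "set_power carrier_set \<inter> space \<mu> \<in> sets \<mu>"
  using power_measuresD(1,2)[OF \<mu>] borel_open[OF open_set_power[OF open_carrier_set]] by simp

lemma tail_measure_eq_distr:
  "tail_measure \<X> \<mu> =
     distr (restrict_space \<mu> (set_power carrier_set)) (borel_on (counting_space \<X>)) (dirac_sum UNIV)"
  (is "_ = ?N")
  and emeasure_tail_measure: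
  "D \<in> sets (borel_on (counting_space \<X>)) \<Longrightarrow>
     emeasure (tail_measure \<X> \<mu>) D = emeasure \<mu> {x. dirac_sum UNIV x \<in> D}"
proof -
  have e: "emeasure ?N D = emeasure \<mu> {x. dirac_sum UNIV x \<in> D}"
    if D: "D \<in> sets (borel_on (counting_space \<X>))" for D
  proof -
    have "dirac_sum UNIV -` D \<inter> space (restrict_space \<mu> (set_power carrier_set)) =
        {x :: 'k \<Rightarrow> 'a. dirac_sum UNIV x \<in> D}"
      using power_measuresD(2)[OF \<mu>] dirac_sum_vimage_borel(2)[OF D] by (auto simp: space_restrict_space)
    then show ?thesis
      using dirac_sum_vimage_borel(2)[OF D] carrier_power_in_sets
      by (simp add: emeasure_distr[OF measurable_dirac_sum_restrict D] emeasure_restrict_space)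
  qed
  have i: "(\<integral>\<^sup>+x. indicator D (dirac_sum UNIV x) \<partial>\<mu>) = emeasure \<mu> {x. dirac_sum UNIV x \<in> D}"
    if D: "D \<in> sets (borel_on (counting_space \<X>))" for D
  proof -
    have "(\<integral>\<^sup>+x. indicator D (dirac_sum UNIV x) \<partial>\<mu>) = (\<integral>\<^sup>+x. indicator {x. dirac_sum UNIV x \<in> D} x \<partial>\<mu>)"
      by (intro nn_integral_cong) (simp add: indicator_def)
    then show ?thesis using dirac_sum_vimage_borel(1)[OF D] power_measuresD(1)[OF \<mu>] by simp
  qed
  have "?N = measure_of (space ?N) (sets ?N) (emeasure ?N)"
    by (rule measure_of_of_measure[symmetric])
  also have "\<dots> = tail_measure \<X> \<mu>"
    unfolding tail_measure_def space_distr sets_distr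
  proof (rule measure_of_eq[OF sets.space_closed])
    fix D assume "D \<in> sigma_sets (space (borel_on (counting_space \<X>))) (sets (borel_on (counting_space \<X>)))"
    then have "D \<in> sets (borel_on (counting_space \<X>))" by (simp only: sets.sigma_sets_eq)
    then show "emeasure ?N D = (\<integral>\<^sup>+x. indicator D (dirac_sum UNIV x) \<partial>\<mu>)" by (simp add: e i)
  qed
  finally show "tail_measure \<X> \<mu> = ?N" by simp
  then show "D \<in> sets (borel_on (counting_space \<X>)) \<Longrightarrow>
     emeasure (tail_measure \<X> \<mu>) D = emeasure \<mu> {x. dirac_sum UNIV x \<in> D}"
    by (simp add: e)
qed

lemma sets_tail_measure: "sets (tail_measure \<X> \<mu>) = sets (borel_on (counting_space \<X>))"
  unfolding tail_measure_eq_distr by simp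

lemma integral_tail_measure:
  fixes f :: "'a measure \<Rightarrow> real"
  assumes f: "f \<in> borel_measurable (borel_on (counting_space \<X>))" and z: "\<And>m. m \<notin> configs \<Longrightarrow> f m = 0"
  shows "(\<integral>m. f m \<partial>tail_measure \<X> \<mu>) = (\<integral>x. f (dirac_sum UNIV x) \<partial>\<mu>)"
proof -
  have "(\<integral>m. f m \<partial>tail_measure \<X> \<mu>) = (\<integral>x. f (dirac_sum UNIV x) \<partial>restrict_space \<mu> (set_power carrier_set))"
    unfolding tail_measure_eq_distr by (rule integral_distr[OF measurable_dirac_sum_restrict f])
  also have "\<dots> = (\<integral>x. indicator (set_power carrier_set) x *\<^sub>R f (dirac_sum UNIV x) \<partial>\<mu>)"
    by (rule integral_restrict_space[OF carrier_power_in_sets])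
  also have "\<dots> = (\<integral>x. f (dirac_sum UNIV x) \<partial>\<mu>)"
    by (intro Bochner_Integration.integral_cong refl)
      (auto simp: indicator_def z dirac_sum_in_configs_iff)
  finally show ?thesis .
qed

lemma tail_measure_in_ideal_measures:
  "tail_measure \<X> \<mu> \<in> ideal_measures (counting_space \<X>) (counting_ideal CARD('k) \<X>)"
  unfolding ideal_measures_def
proof (intro CollectI conjI ballI impI)
  show "sets (tail_measure \<X> \<mu>) = sets (borel_on (counting_space \<X>))" by (rule sets_tail_measure)
next
  fix D assume "D \<in> counting_ideal CARD('k) \<X> \<inter> sets (borel_on (counting_space \<X>))"
  then obtain A where D: "D \<in> sets (borel_on (counting_space \<X>))"
    and A: "A \<in> \<X>" "A \<in> sets borel" "\<And>m. m \<in> D \<Longrightarrow> of_nat CARD('k) \<le> emeasure m A"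
    by (auto simp: counting_ideal_def)
  have "{x :: 'k \<Rightarrow> 'a. dirac_sum UNIV x \<in> D} \<subseteq> set_power A"
    using A(3) dirac_sum_emeasure_ge_iff[OF A(2)] by auto
  then have "emeasure \<mu> {x. dirac_sum UNIV x \<in> D} \<le> emeasure \<mu> (set_power A)"
    using set_power_borel[OF A(2)] power_measuresD(1)[OF \<mu>] by (intro emeasure_mono) auto
  then show "emeasure (tail_measure \<X> \<mu>) D < \<infinity>"
    using power_measuresD(3)[OF \<mu> A(1,2)] by (simp add: emeasure_tail_measure[OF D])
next
  fix D assume D: "D \<in> sets (borel_on (counting_space \<X>))" and dis: "D \<inter> \<Union>(counting_ideal CARD('k) \<X>) = {}"
  have "{x :: 'k \<Rightarrow> 'a. dirac_sum UNIV x \<in> D} = {}"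
    using dirac_sum_vimage_borel(2)[OF D] dis dirac_sum_in_Union_counting_ideal[where 'k='k] by blast
  then show "emeasure (tail_measure \<X> \<mu>) D = 0" by (simp add: emeasure_tail_measure[OF D])
qed

lemma tail_measure_nontrivial:
  assumes "nontrivial_on (power_ideal \<X>) \<mu>"
  shows "nontrivial_on (counting_ideal CARD('k) \<X>) (tail_measure \<X> \<mu>)"
proof -
  obtain B where B: "B \<in> power_ideal \<X>" "B \<in> sets \<mu>" "0 < emeasure \<mu> B"
    using assms by (auto simp: nontrivial_on_def)
  then obtain A where A: "A \<in> \<X>" "B \<subseteq> set_power A" by (auto simp: power_ideal_def)
  obtain i where i: "A \<subseteq> U i" using ideal_base[OF A(1)] by auto
  define D where "D = {m \<in> configs. of_nat CARD('k) \<le> emeasure m (U i)}"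
  have D: "D \<in> sets (borel_on (counting_space \<X>))"
    unfolding D_def by (intro openin_in_sets_borel_on openin_emeasure_ge) auto
  have "{x :: 'k \<Rightarrow> 'a. dirac_sum UNIV x \<in> D} = set_power (U i)"
    using U_in_ideal[of i]
    by (auto simp: D_def dirac_sum_emeasure_ge_iff dirac_sum_in_configs_iff) (auto simp: set_power_def)
  moreover have "emeasure \<mu> B \<le> emeasure \<mu> (set_power (U i))"
    using A(2) i set_power_borel[of "U i"] power_measuresD(1)[OF \<mu>]
    by (intro emeasure_mono) (auto simp: set_power_def)
  ultimately have "0 < emeasure (tail_measure \<X> \<mu>) D"
    using B(3) by (simp add: emeasure_tail_measure[OF D])
  moreover have "D \<in> counting_ideal CARD('k) \<X>"
    by (auto simp: counting_ideal_def D_def intro!: bexI[of _ "U i"])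
  ultimately show ?thesis using D by (auto simp: nontrivial_on_def sets_tail_measure)
qed

end

end

context janossy_convergence begin

text \<open>The lower bound is applied to \<open>M \<psi> + f\<close> and \<open>M \<psi> - f\<close>, which are nonnegative since \<open>\<psi> = 1\<close> on the support
  of \<open>f\<close>; the known limit for \<open>M \<psi>\<close> is then subtracted.\<close>
lemma rescaled_integral_tendsto:
  assumes f: "f \<in> ideal_test_functions (counting_space \<X>) (counting_ideal CARD('k) \<X>)"
  shows "((\<lambda>t. g t * (\<integral>\<omega>. f (rescaled t \<omega>) \<partial>P)) \<longlongrightarrow> (\<integral>m. f m \<partial>tail_measure \<X> \<mu>)) at_top"
proof -
  let ?Y = "\<Union>(counting_ideal CARD('k) \<X>)"
  have cf: "continuous_map (subtopology (counting_space \<X>) ?Y) euclideanreal f"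
    and bf: "bounded (f ` ?Y)" and fz: "\<And>m. m \<notin> ?Y \<Longrightarrow> f m = 0"
    and cl: "counting_space \<X> closure_of {m \<in> ?Y. f m \<noteq> 0} \<in> counting_ideal CARD('k) \<X>"
    using f by (auto simp: ideal_test_functions_def)
  have YE: "?Y \<subseteq> configs" by (auto simp: counting_ideal_def)
  obtain M0 where M0: "\<And>m. m \<in> ?Y \<Longrightarrow> \<bar>f m\<bar> \<le> M0" using bf by (auto simp: bounded_iff)
  define M where "M = max 0 M0"
  have M: "0 \<le> M" "\<bar>f m\<bar> \<le> M" for m
    using M0[of m] fz[of m] by (cases "m \<in> ?Y"; auto simp: M_def)+
  obtain A where A: "A \<in> \<X>" "A \<in> sets borel"
    "\<And>m. m \<in> counting_space \<X> closure_of {m \<in> ?Y. f m \<noteq> 0} \<Longrightarrow> of_nat CARD('k) \<le> emeasure m A"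
    using cl by (auto simp: counting_ideal_def)
  have supp: "m \<in> configs" "of_nat CARD('k) \<le> emeasure m A" if "f m \<noteq> 0" for m
  proof -
    have "m \<in> ?Y" using fz that by blast
    then show "m \<in> configs" using YE by blast
    have "{m \<in> ?Y. f m \<noteq> 0} \<subseteq> counting_space \<X> closure_of {m \<in> ?Y. f m \<noteq> 0}"
      using YE by (intro closure_of_subset) auto
    then show "of_nat CARD('k) \<le> emeasure m A" using \<open>m \<in> ?Y\<close> that by (intro A(3)) blast
  qed
  obtain \<psi> where \<psi>: "continuous_map (subtopology (counting_space \<X>) ?Y) euclideanreal \<psi>"
    "\<And>m. 0 \<le> \<psi> m" "\<And>m. \<psi> m \<le> 1" "\<And>m. m \<notin> ?Y \<Longrightarrow> \<psi> m = 0"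
    "\<And>m. m \<in> configs \<Longrightarrow> of_nat CARD('k) \<le> emeasure m A \<Longrightarrow> \<psi> m = 1"
    "integrable \<mu> (\<lambda>x. \<psi> (dirac_sum UNIV x))"
    "((\<lambda>t. g t * (\<integral>\<omega>. \<psi> (rescaled t \<omega>) \<partial>P)) \<longlongrightarrow> (\<integral>x. \<psi> (dirac_sum UNIV x) \<partial>\<mu>)) at_top"
    by (rule dominating_function_exists[OF A(1,2)]) (rule that; assumption)
  have if\<mu>: "integrable \<mu> (\<lambda>x. f (dirac_sum UNIV x))"
  proof (rule integrable_power_measure[OF \<mu> _ M(2) A(1,2)])
    show "(\<lambda>x :: 'k \<Rightarrow> 'a. f (dirac_sum UNIV x)) \<in> borel_measurable borel"
      by (rule borel_measurable_dirac_sum_comp[OF cf fz])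
    show "f (dirac_sum UNIV x) = 0" if "x \<notin> set_power A" for x :: "'k \<Rightarrow> 'a"
      using supp(2)[of "dirac_sum UNIV x"] that dirac_sum_emeasure_ge_iff[OF A(2)] by auto
  qed
  let ?a = "\<lambda>t. g t * (\<integral>\<omega>. f (rescaled t \<omega>) \<partial>P)" and ?b = "\<lambda>t. g t * (\<integral>\<omega>. \<psi> (rescaled t \<omega>) \<partial>P)"
  let ?\<alpha> = "\<integral>x. f (dirac_sum UNIV x) \<partial>\<mu>" and ?\<beta> = "\<integral>x. \<psi> (dirac_sum UNIV x) \<partial>\<mu>"
  have low: "\<forall>\<^sub>F t in at_top. s * ?\<alpha> - e < s * ?a t" if s: "\<bar>s\<bar> = 1" and e: "0 < e" for s e :: real
  proof -
    define F where "F m = s * f m + M * \<psi> m" for m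
    have bnd: "\<bar>s * f m\<bar> \<le> M * \<psi> m" for m
    proof (cases "f m = 0")
      case True
      then show ?thesis using M(1) \<psi>(2) by simp
    next
      case False
      then show ?thesis using \<psi>(5)[OF supp[OF False]] M(2)[of m] s by (simp add: abs_mult)
    qed
    have cF: "continuous_map (subtopology (counting_space \<X>) ?Y) euclideanreal F"
      unfolding F_def using cf \<psi>(1) by (intro continuous_intros) auto
    have "0 \<le> F m" for m using bnd[of m] by (simp add: F_def abs_le_iff)
    moreover have "F m \<le> 2 * M" for m
      using bnd[of m] mult_left_mono[OF \<psi>(3)[of m] M(1)] by (simp add: F_def abs_le_iff)
    moreover have "F m = 0" if "m \<notin> ?Y" for m using fz[OF that] \<psi>(4)[OF that] by (simp add: F_def)
    moreover have "integrable \<mu> (\<lambda>x. F (dirac_sum UNIV x))" unfolding F_def using if\<mu> \<psi>(6) by auto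
    moreover have "(\<integral>x. F (dirac_sum UNIV x) \<partial>\<mu>) = s * ?\<alpha> + M * ?\<beta>"
      unfolding F_def using if\<mu> \<psi>(6) by simp
    then have "s * ?\<alpha> + M * ?\<beta> - e / 2 < (\<integral>x. F (dirac_sum UNIV x) \<partial>\<mu>)" using e by simp
    ultimately have "\<forall>\<^sub>F t in at_top. s * ?\<alpha> + M * ?\<beta> - e / 2 < g t * (\<integral>\<omega>. F (rescaled t \<omega>) \<partial>P)"
      by (rule eventually_greater_than_below_limit[OF cF])
    moreover have "((\<lambda>t. M * ?b t) \<longlongrightarrow> M * ?\<beta>) at_top" by (intro tendsto_intros \<psi>(7))
    then have "\<forall>\<^sub>F t in at_top. M * ?b t < M * ?\<beta> + e / 2"
      using e by (intro order_tendstoD(2)) auto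
    moreover have "\<forall>\<^sub>F t :: real in at_top. 0 < t" by (rule eventually_gt_at_top)
    ultimately show ?thesis
    proof eventually_elim
      case (elim t)
      have "integrable P (\<lambda>\<omega>. f (rescaled t \<omega>))"
        using M(2) by (intro integrable_const_bound[of _ M] borel_measurable_rescaled[OF elim(3) cf fz]) auto
      moreover have "integrable P (\<lambda>\<omega>. \<psi> (rescaled t \<omega>))"
        using \<psi>(2,3) by (intro integrable_const_bound[of _ 1] borel_measurable_rescaled[OF elim(3) \<psi>(1,4)]) auto
      ultimately have "g t * (\<integral>\<omega>. F (rescaled t \<omega>) \<partial>P) = s * ?a t + M * ?b t"
        unfolding F_def by (simp add: algebra_simps)
      then show ?case using elim(1,2) by simp
    qed
  qed
  have "(?a \<longlongrightarrow> ?\<alpha>) at_top"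
  proof (rule order_tendstoI)
    fix c assume "c < ?\<alpha>"
    then show "\<forall>\<^sub>F t in at_top. c < ?a t" using low[of 1 "?\<alpha> - c"] by simp
  next
    fix c assume "?\<alpha> < c"
    then show "\<forall>\<^sub>F t in at_top. ?a t < c" using low[of "-1" "c - ?\<alpha>"] by simp
  qed
  moreover have "f \<in> borel_measurable (borel_on (counting_space \<X>))"
    by (rule borel_measurable_zero_extension[OF openin_Union_counting_ideal cf fz])
  then have "(\<integral>m. f m \<partial>tail_measure \<X> \<mu>) = ?\<alpha>"
    using YE fz by (intro integral_tail_measure[OF \<mu>]) blast+
  ultimately show ?thesis by simp
qed

end

theorem theorem4p6p9:
  fixes \<X> :: "'a::polish_space set set"
    and T :: "real \<Rightarrow> 'a \<Rightarrow> 'a"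
    and U :: "nat \<Rightarrow> 'a set"
    and P :: "'w measure"
    and \<eta> :: "'w \<Rightarrow> 'a measure"
    and g :: "real \<Rightarrow> real"
    and \<mu> :: "('k::finite \<Rightarrow> 'a) measure"
  assumes "continuous_scaling euclidean T"
    and "ideal_on euclidean \<X>"
    and "topologically_consistent euclidean \<X>"
    and "scaling_consistent T \<X>"
    and "countable_open_base euclidean \<X> U"
    and "prob_space P"
    and "\<eta> \<in> measurable P (borel_on (counting_space \<X>))"
    and "\<And>t i. t \<ge> 1 \<Longrightarrow>
           measure P {\<omega> \<in> space P. emeasure (\<eta> \<omega>) (T t ` U i) = of_nat CARD('k)} > 0"
    and "g \<in> borel_measurable (restrict_space borel {0..})"
    and "\<And>t. t \<ge> 0 \<Longrightarrow> g t \<ge> 0"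
    and "filterlim g at_top at_top"
    and "\<mu> \<in> ideal_measures euclidean (power_ideal \<X>)"
    and "nontrivial_on (power_ideal \<X>) \<mu>"
    and "\<And>B h. B \<in> \<X> \<Longrightarrow> B \<in> sets borel \<Longrightarrow> continuous_on UNIV h \<Longrightarrow> bounded (range h) \<Longrightarrow>
           closure {x. h x \<noteq> 0} \<subseteq> set_power B \<Longrightarrow>
           ((\<lambda>t. g t * (\<integral>x. h (\<lambda>j. T (inverse t) (x j)) \<partial>janossy_measure P \<eta> (T t ` B)))
              \<longlongrightarrow> (\<integral>x. h x \<partial>\<mu>)) at_top"
    and "\<And>i. ((\<lambda>t. g t * measure P {\<omega> \<in> space P.
                    emeasure (\<eta> \<omega>) (T t ` U i) \<ge> of_nat (CARD('k) + 1)}) \<longlongrightarrow> 0) at_top"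
  shows "regularly_varying P \<eta> (counting_space \<X>) (push_scaling T)
           (counting_ideal CARD('k) \<X>) g (tail_measure \<X> \<mu>)"
proof -
  interpret prob_space P by fact
  interpret janossy_convergence \<X> U T P \<eta> g \<mu>
    by unfold_locales (fact assms)+
  show ?thesis
    unfolding regularly_varying_def
    using assms tail_measure_in_ideal_measures[OF \<mu>] tail_measure_nontrivial[OF \<mu>] rescaled_integral_tendsto
    by blast
qed

end
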